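(* Fix a triangle $T$ in the Euclidean plane $\mathbb{R}^2$. Then three triangles isometric to $T$ and three equilateral triangles with side lengths equal to the sides of $T$ (the edge lengths of the three equilateral triangles being equal to the three edge lengths of $T$) can be glued together to make a hexagon which tiles the plane with symmetry group $\mathsf{S}(3,3,3)$. Around each vertex of the resulting triangulation of the plane, the angles are the three interior angles of $T$ together with three angles equal to $\frac{2\pi}{6}$.
   Context: $\mathsf{S}(3,3,3)$ denotes the symmetry group of the plane generated by three rotations of order $3$ with centers at the vertices of an equilateral triangle. The tiling is by copies of the hexagon, each divided into its six constituent triangles (three isometric to $T$ and three equilateral, one for each side of $T$), which gives a triangulation of the plane.
   Formalization: For all T, the symmetry group is that of isometries preserving the four kinds of triangles; for the unmarked tiling equality with S(3,3,3) is stated only for scalene T (it fails for isosceles T). The hexagon may have straight vertices if T has an angle 2π/3. *)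

theory Defs
  imports
    "HOL-Analysis.Analysis"
    "HOL-Library.Multiset"
    "HOL-Algebra.Bij"
    "HOL-Algebra.Generated_Groups"
begin

text \<open>The Euclidean plane is the type \<^typ>\<open>complex\<close> with its standard metric.\<close>

definition isometry :: "(complex \<Rightarrow> complex) \<Rightarrow> bool" where
  "isometry f \<longleftrightarrow> (\<forall>x y. dist (f x) (f y) = dist x y)"

definition isometric :: "complex set \<Rightarrow> complex set \<Rightarrow> bool" where
  "isometric K L \<longleftrightarrow> (\<exists>f. isometry f \<and> f ` K = L)"

definition equilateral_triangle :: "real \<Rightarrow> complex set \<Rightarrow> bool" where
  "equilateral_triangle s E \<longleftrightarrow> s > 0 \<and>
     (\<exists>x y z. dist x y = s \<and> dist y z = s \<and> dist z x = s \<and> E = convex hull {x, y, z})"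

definition angle :: "complex \<Rightarrow> complex \<Rightarrow> complex \<Rightarrow> real" where
  "angle a v b = arccos (((a - v) \<bullet> (b - v)) / (norm (a - v) * norm (b - v)))"

text \<open>Meaningful only if \<open>K\<close> is a nondegenerate triangle and \<open>v\<close> is one of its vertices;
  the other two vertices are then determined by \<open>K\<close> and \<open>v\<close>.\<close>

definition interior_angle :: "complex set \<Rightarrow> complex \<Rightarrow> real" where
  "interior_angle K v =
     (THE \<theta>. \<exists>a b. \<not> collinear {v, a, b} \<and> K = convex hull {v, a, b} \<and> \<theta> = angle a v b)"

definition hexagon_boundary :: "(nat \<Rightarrow> complex) \<Rightarrow> real \<Rightarrow> complex" where
  "hexagon_boundary h =
     linepath (h 0) (h 1) +++ linepath (h 1) (h 2) +++ linepath (h 2) (h 3) +++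
     linepath (h 3) (h 4) +++ linepath (h 4) (h 5) +++ linepath (h 5) (h 0)"

text \<open>\<open>H\<close> is the closed region bounded by the simple closed polygon with consecutive
  vertices \<open>h 0, \<dots>, h 5\<close>. It need not be convex, and a vertex may have a straight angle:
  gluing a triangle with an angle of \<open>2\<pi>/3\<close> to an equilateral triangle produces one.\<close>

definition hexagon :: "(nat \<Rightarrow> complex) \<Rightarrow> complex set \<Rightarrow> bool" where
  "hexagon h H \<longleftrightarrow> simple_path (hexagon_boundary h) \<and>
     H = path_image (hexagon_boundary h) \<union> inside (path_image (hexagon_boundary h))"

definition no_straight_vertex :: "(nat \<Rightarrow> complex) \<Rightarrow> bool" where
  "no_straight_vertex h \<longleftrightarrow>
     (\<forall>i<6. \<not> collinear {h i, h ((i + 1) mod 6), h ((i + 2) mod 6)})"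

text \<open>The copies of the tile \<open>H\<close> are indexed by the isometries placing them.\<close>

definition tiles_plane :: "complex set \<Rightarrow> (complex \<Rightarrow> complex) set \<Rightarrow> bool" where
  "tiles_plane H P \<longleftrightarrow> (\<forall>f\<in>P. isometry f) \<and> (\<Union>f\<in>P. f ` H) = UNIV \<and>
     (\<forall>f\<in>P. \<forall>g\<in>P. f \<noteq> g \<longrightarrow> interior (f ` H) \<inter> interior (g ` H) = {})"

text \<open>The library's \<^const>\<open>triangulation\<close> is restricted to finite families.\<close>

definition plane_triangulation :: "complex set set \<Rightarrow> bool" where
  "plane_triangulation \<K> \<longleftrightarrow> locally_finite_in euclidean \<K> \<and> \<Union>\<K> = UNIV \<and>
     (\<forall>K\<in>\<K>. 2 simplex K) \<and>
     (\<forall>K\<in>\<K>. \<forall>L\<in>\<K>. (K \<inter> L) face_of K)"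

text \<open>The symmetries of a tiling whose tiles come in several kinds, each family in \<open>\<C>\<close>
  being the set of all tiles of one kind: isometries taking every tile to a tile of the
  same kind. With a single family this is the usual symmetry group.\<close>

definition symmetries :: "complex set set set \<Rightarrow> (complex \<Rightarrow> complex) set" where
  "symmetries \<C> = {f. isometry f \<and> (\<forall>\<K>\<in>\<C>. (`) f ` \<K> = \<K>)}"

definition rotation :: "complex \<Rightarrow> real \<Rightarrow> complex \<Rightarrow> complex" where
  "rotation c \<theta> z = c + cis \<theta> * (z - c)"

definition S333 :: "complex \<Rightarrow> complex \<Rightarrow> complex \<Rightarrow> (complex \<Rightarrow> complex) set" where
  "S333 p q r = generate (BijGroup UNIV)
     {rotation p (2 * pi / 3), rotation q (2 * pi / 3), rotation r (2 * pi / 3)}"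

end

theory Submission
  imports Defs
begin

text \<open>
  The regular triangular tiling of the plane folds onto one of its triangles: let \<open>\<psi>\<close> be the folding
  map, which sends every tile isometrically onto that triangle, reversing orientation on the upward
  tiles and preserving it on the downward ones. For complex numbers \<open>\<beta>\<close> and \<open>Q\<close> consider
  \<open>\<Phi> z = \<beta> z + Q \<psi> z\<close>. On an upward tile \<open>\<Phi>\<close> is affine with linear part \<open>z \<mapsto> \<beta> z + Q \<rho> cnj z\<close>
  for a cube root of unity \<open>\<rho>\<close>, so all upward tiles become triangles congruent to a single one, and
  every positively oriented triangle arises for exactly one pair \<open>(\<beta>, Q)\<close>, with \<open>\<bar>Q\<bar> < \<bar>\<beta>\<bar>\<close>.
  On a downward tile \<open>\<Phi>\<close> is a similarity, so it becomes an equilateral triangle erected on the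
  sides of its three neighbours.

  Since \<open>\<psi>\<close> is 1-Lipschitz, \<open>\<bar>Q\<bar> < \<bar>\<beta>\<bar>\<close> makes \<open>\<Phi>\<close> a homeomorphism of the plane, so the deformed
  tiles form a triangulation because the regular ones do, and the star of a vertex, a regular hexagon
  before deformation, becomes the hexagonal tile. The rotations of order 3 of the regular tiling about
  the centres of downward tiles intertwine with rotations under \<open>\<Phi>\<close>, which gives the symmetry group.
\<close>

text \<open>Gluing tiles around a vertex directly would leave overlaps to be excluded for hexagons
  that may be nonconvex or have straight vertices; carrying everything over by one homeomorphism
  avoids these cases. The fold rests on the 3-colouring of the lattice by m - n modulo 3, written as
  a cube root of unity: each tile has one vertex of each colour, so its vertices go to the three
  corners of a single triangle. The condition on \<open>beta\<close> and \<open>Q\<close> is one of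
  orientation: twice the signed area of a deformed upward tile is sqrt 3 / 2 times the difference of
  their squared norms. A reflection of the given triangle therefore settles the other orientation.
  The colours also label the downward tiles and separate the three families of equilateral
  triangles. Symmetries are required to respect these families, because special triangles give the
  uncoloured tiling more symmetry: an equilateral one yields the regular tiling. When the three
  sides differ, side lengths alone recover the families.\<close>

lemma convex_hull_image_explicit:
  fixes f :: "'a \<Rightarrow> 'b::real_vector"
  assumes "finite T"
  shows "convex hull (f ` T) = {\<Sum>t\<in>T. c t *\<^sub>R f t | c. (\<forall>t\<in>T. 0 \<le> c t) \<and> sum c T = (1::real)}"
    (is "_ = ?R")
proof
  show "convex hull (f ` T) \<subseteq> ?R"
  proof (rule hull_minimal)
    show "f ` T \<subseteq> ?R"
    proof
      fix x assume "x \<in> f ` T"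
      then obtain s where s: "s \<in> T" "x = f s" by auto
      let ?c = "\<lambda>t. if t = s then 1 else (0::real)"
      have "(\<Sum>t\<in>T. ?c t *\<^sub>R f t) = (\<Sum>t\<in>T. if t = s then f t else 0)"
        by (rule sum.cong) auto
      with s assms have "(\<Sum>t\<in>T. ?c t *\<^sub>R f t) = x" "sum ?c T = 1"
        by auto
      then show "x \<in> ?R"
        by (intro CollectI exI[of _ ?c]) auto
    qed
    show "convex ?R"
    proof (rule convexI)
      fix x y and a b :: real
      assume "x \<in> ?R" "y \<in> ?R" and ab: "0 \<le> a" "0 \<le> b" "a + b = 1"
      then obtain c d where
        c: "\<forall>t\<in>T. 0 \<le> c t" "sum c T = 1" "x = (\<Sum>t\<in>T. c t *\<^sub>R f t)" and
        d: "\<forall>t\<in>T. 0 \<le> d t" "sum d T = 1" "y = (\<Sum>t\<in>T. d t *\<^sub>R f t)" by auto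
      have "a *\<^sub>R x + b *\<^sub>R y = (\<Sum>t\<in>T. (a * c t + b * d t) *\<^sub>R f t)"
        unfolding c d by (simp add: scaleR_sum_right sum.distrib scaleR_add_left)
      moreover have "(\<Sum>t\<in>T. a * c t + b * d t) = 1"
        using c d ab by (simp add: sum.distrib flip: sum_distrib_left)
      moreover have "\<forall>t\<in>T. 0 \<le> a * c t + b * d t"
        using c d ab by auto
      ultimately show "a *\<^sub>R x + b *\<^sub>R y \<in> ?R"
        by (intro CollectI exI[of _ "\<lambda>t. a * c t + b * d t"]) auto
    qed
  qed
  show "?R \<subseteq> convex hull (f ` T)"
    using assms by (force intro!: convex_sum simp: hull_inc)
qed

section \<open>The regular triangulation\<close>

definition om :: complex where "om = Complex (1/2) (sqrt 3 / 2)"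

definition lat :: "int \<times> int \<Rightarrow> complex" where
  "lat v = of_int (fst v) + of_int (snd v) * om"

definition cY :: "complex \<Rightarrow> real" where "cY z = 2 * Im z / sqrt 3"
definition cX :: "complex \<Rightarrow> real" where "cX z = Re z - Im z / sqrt 3"

text \<open>The norm whose unit ball is the regular hexagon with corners at the six lattice
  neighbours of 0, that is, the star of 0 in the regular tiling.\<close>

definition hexnorm :: "complex \<Rightarrow> real" where
  "hexnorm z = max \<bar>cX z\<bar> (max \<bar>cY z\<bar> \<bar>cX z + cY z\<bar>)"

text \<open>The tent function at \<open>lat v\<close>: on a cell with vertex \<open>v\<close> it is
  the barycentric coordinate of \<open>v\<close>, on every other cell it is 0. As the formula
  mentions no cell, coordinates taken in different cells can be compared at once.\<close>

definition hat :: "complex \<Rightarrow> int \<times> int \<Rightarrow> real" where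
  "hat z v = max 0 (1 - hexnorm (z - lat v))"

definition up :: "int \<times> int \<Rightarrow> (int \<times> int) set" where
  "up v = {v, v + (1,0), v + (0,1)}"

definition down :: "int \<times> int \<Rightarrow> (int \<times> int) set" where
  "down v = {v + (1,0), v + (0,1), v + (1,1)}"

text \<open>Cells are sets of vertex indices, so that the regular and the deformed tiling share them
  and intersections of tiles are computed on finite sets.\<close>

definition cells :: "(int \<times> int) set set" where
  "cells = range up \<union> range down"

lemma Re_om [simp]: "Re om = 1/2" and Im_om [simp]: "Im om = sqrt 3 / 2"
  by (simp_all add: om_def)

lemma norm_om [simp]: "norm om = 1"
  by (simp add: cmod_def power2_eq_square)

lemma om_nz [simp]: "om \<noteq> 0"
  using norm_om by fastforce

lemma cXY_eq: "z = of_real (cX z) + of_real (cY z) * om"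
  by (simp add: complex_eq_iff cX_def cY_def field_simps)

lemma cX_add [simp]: "cX (z + w) = cX z + cX w" and cY_add [simp]: "cY (z + w) = cY z + cY w"
  and cX_diff [simp]: "cX (z - w) = cX z - cX w" and cY_diff [simp]: "cY (z - w) = cY z - cY w"
  and cX_scaleR [simp]: "cX (r *\<^sub>R z) = r * cX z" and cY_scaleR [simp]: "cY (r *\<^sub>R z) = r * cY z"
  and cX_mult_real [simp]: "cX (of_real r * z) = r * cX z" and cY_mult_real [simp]: "cY (of_real r * z) = r * cY z"
  by (simp_all add: cX_def cY_def field_simps)

lemma cX_lat [simp]: "cX (lat v) = of_int (fst v)" and cY_lat [simp]: "cY (lat v) = of_int (snd v)"
  by (simp_all add: cX_def cY_def lat_def field_simps)

lemma complex_eqI_XY: "cX z = cX w \<Longrightarrow> cY z = cY w \<Longrightarrow> z = w"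
  by (metis cXY_eq)

lemma continuous_cX [continuous_intros]: "continuous_on S f \<Longrightarrow> continuous_on S (\<lambda>x. cX (f x))"
  and continuous_cY [continuous_intros]: "continuous_on S f \<Longrightarrow> continuous_on S (\<lambda>x. cY (f x))"
  unfolding cX_def cY_def by (auto intro!: continuous_intros)

lemma lat_add: "lat (v + w) = lat v + lat w"
  by (simp add: lat_def algebra_simps)

lemma lat_diff: "lat (v - w) = lat v - lat w"
  by (simp add: lat_def algebra_simps)

lemma lat_zero [simp]: "lat 0 = 0"
  by (simp add: lat_def)

lemma inj_lat: "inj lat"
proof
  fix v w assume "lat v = lat w"
  then have "cX (lat v) = cX (lat w)" "cY (lat v) = cY (lat w)" by auto
  then show "v = w" by (simp add: prod_eq_iff)
qed

lemma sum_up: "(\<Sum>s\<in>up v. g s) = g v + g (v + (1,0)) + g (v + (0,1))"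
  for g :: "int \<times> int \<Rightarrow> 'b::comm_monoid_add"
  unfolding up_def by (cases v) (simp add: add_ac)

lemma sum_down: "(\<Sum>s\<in>down v. g s) = g (v + (1,0)) + g (v + (0,1)) + g (v + (1,1))"
  for g :: "int \<times> int \<Rightarrow> 'b::comm_monoid_add"
  unfolding down_def by (cases v) (simp add: add_ac)

lemma finite_cell: "S \<in> cells \<Longrightarrow> finite S"
  by (auto simp: cells_def up_def down_def)

lemma card_cell: "S \<in> cells \<Longrightarrow> card S = 3"
  by (auto simp: cells_def up_def down_def)

lemma hat_zeroI: "1 \<le> \<bar>cX z - of_int (fst v)\<bar> \<or> 1 \<le> \<bar>cY z - of_int (snd v)\<bar> \<or>
    1 \<le> \<bar>cX z + cY z - of_int (fst v + snd v)\<bar> \<Longrightarrow> hat z v = 0"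
  by (auto simp: hat_def hexnorm_def algebra_simps)

text \<open>In lattice coordinates based at \<open>v\<close> the point is \<open>(b, d)\<close> in
  the standard triangle, so the tent of each lattice point can be read off from the three terms of
  \<open>hexnorm\<close>.\<close>

lemma hat_combination_up:
  assumes "\<forall>s\<in>up v. 0 \<le> c s" "sum c (up v) = 1" "z = (\<Sum>s\<in>up v. c s *\<^sub>R lat s)"
  shows "hat z s = (if s \<in> up v then c s else 0)"
proof -
  define a b d where "a = c v" "b = c (v + (1,0))" "d = c (v + (0,1))"
  have abd: "a \<ge> 0" "b \<ge> 0" "d \<ge> 0" and a: "a = 1 - b - d"
    using assms(1,2) by (auto simp: a_b_d_def up_def sum_up[unfolded up_def])
  have z: "z = a *\<^sub>R lat v + b *\<^sub>R lat (v + (1,0)) + d *\<^sub>R lat (v + (0,1))"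
    using assms(3) by (simp add: sum_up a_b_d_def)
  have X: "cX z = of_int (fst v) + b" and Y: "cY z = of_int (snd v) + d"
    unfolding z a by (simp_all add: algebra_simps)
  obtain i j where s: "s = v + (i, j)" by (metis diff_add_cancel add.commute surj_pair)
  consider "i = 0" "j = 0" | "i = 1" "j = 0" | "i = 0" "j = 1" | "i = 1" "j = 1" |
     "i \<ge> 2" | "i \<le> -1" | "j \<ge> 2" | "j \<le> -1" by linarith
  then show ?thesis
  proof cases
    case 1
    then have "s = v" by (cases v) (simp add: s)
    then show ?thesis using abd a by (simp add: hat_def hexnorm_def X Y up_def a_b_d_def[symmetric])
  next
    case 2
    then have "s \<in> up v" "c s = b" by (simp_all add: s up_def a_b_d_def)
    moreover have "hat z s = b"
      using abd a 2 by (auto simp add: s hat_def hexnorm_def X Y max_def abs_if)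
    ultimately show ?thesis by simp
  next
    case 3
    then have "s \<in> up v" "c s = d" by (simp_all add: s up_def a_b_d_def)
    moreover have "hat z s = d"
      using abd a 3 by (auto simp add: s hat_def hexnorm_def X Y max_def abs_if)
    ultimately show ?thesis by simp
  next
    case 4
    \<comment> \<open>Each coordinate alone may be closer than 1 to that of
      \<open>v + (1,1)\<close>; their sum is not, because \<open>b + d\<close> is at most 1.\<close>
    then have "hat z s = 0" using abd a by (intro hat_zeroI) (simp add: s X Y)
    then show ?thesis using 4 by (cases v) (simp add: s up_def)
  next
    case 5
    then have "real_of_int i \<ge> 2" by simp
    then have "hat z s = 0" using abd a by (intro hat_zeroI) (simp add: s X Y)
    then show ?thesis using 5 by (cases v) (simp add: s up_def)
  next
    case 6
    then have "real_of_int i \<le> -1" by (metis of_int_le_iff of_int_minus of_int_1)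
    then have "hat z s = 0" using abd a by (intro hat_zeroI) (simp add: s X Y)
    then show ?thesis using 6 by (cases v) (simp add: s up_def)
  next
    case 7
    then have "real_of_int j \<ge> 2" by simp
    then have "hat z s = 0" using abd a by (intro hat_zeroI) (simp add: s X Y)
    then show ?thesis using 7 by (cases v) (simp add: s up_def)
  next
    case 8
    then have "real_of_int j \<le> -1" by (metis of_int_le_iff of_int_minus of_int_1)
    then have "hat z s = 0" using abd a by (intro hat_zeroI) (simp add: s X Y)
    then show ?thesis using 8 by (cases v) (simp add: s up_def)
  qed
qed

text \<open>Reflection in the origin swaps upward and downward cells, which reduces the downward
  case of \<open>hat_combination\<close> to the upward one.\<close>

lemma uminus_down: "uminus ` down v = up (- v - (1,1))"
  by (cases v) (simp add: up_def down_def insert_commute)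

lemma hat_uminus: "hat (- z) (- v) = hat z v"
proof -
  have "lat (- v) = - lat v" by (simp add: lat_def)
  moreover have "hexnorm (- x) = hexnorm x" for x
    using cX_scaleR[of "-1" x] cY_scaleR[of "-1" x] by (simp add: hexnorm_def max_def abs_if)
  ultimately show ?thesis
    by (simp add: hat_def) (metis minus_diff_eq minus_diff_commute)
qed

lemma hat_combination:
  assumes "S \<in> cells" "\<forall>s\<in>S. 0 \<le> c s" "sum c S = 1" "z = (\<Sum>s\<in>S. c s *\<^sub>R lat s)"
  shows "hat z s = (if s \<in> S then c s else 0)"
  using assms(1) unfolding cells_def
proof
  assume "S \<in> range up"
  then show ?thesis using hat_combination_up assms by blast
next
  assume "S \<in> range down"
  then obtain v where v: "S = down v" by auto
  let ?v = "- v - (1,1)" and ?c = "\<lambda>s. c (- s)"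
  have S: "up ?v = uminus ` S" by (simp add: v uminus_down)
  have lm: "lat (- v) = - lat v" for v by (simp add: lat_def)
  have "hat (- z) (- s) = (if - s \<in> up ?v then ?c (- s) else 0)"
  proof (rule hat_combination_up)
    show "\<forall>s\<in>up ?v. 0 \<le> ?c s" "sum ?c (up ?v) = 1" "- z = (\<Sum>s\<in>up ?v. ?c s *\<^sub>R lat s)"
      unfolding S using assms(2-4) by (auto simp: sum.reindex lm sum_negf)
  qed
  moreover have "- s \<in> uminus ` S \<longleftrightarrow> s \<in> S" by (auto simp: image_iff)
  ultimately show ?thesis by (simp add: S hat_uminus)
qed

definition rtri :: "(int \<times> int) set \<Rightarrow> complex set" where
  "rtri S = convex hull (lat ` S)"

lemma hat_face:
  assumes "S \<in> cells" "T \<subseteq> S" "z \<in> rtri T"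
  shows "\<And>s. s \<notin> T \<Longrightarrow> hat z s = 0" "sum (hat z) T = 1" "z = (\<Sum>s\<in>T. hat z s *\<^sub>R lat s)"
proof -
  have fin: "finite S" "finite T" using assms finite_cell finite_subset by blast+
  obtain c where c: "\<forall>t\<in>T. 0 \<le> c t" "sum c T = 1" "z = (\<Sum>t\<in>T. c t *\<^sub>R lat t)"
    using assms(3) unfolding rtri_def by (auto simp: convex_hull_image_explicit fin)
  let ?c = "\<lambda>s. if s \<in> T then c s else 0"
  have "sum ?c S = sum c T" "(\<Sum>s\<in>S. ?c s *\<^sub>R lat s) = (\<Sum>s\<in>T. c s *\<^sub>R lat s)"
    using assms fin by (auto intro!: sum.mono_neutral_cong_right)
  then have *: "hat z s = ?c s" for s
    using hat_combination[OF assms(1), of ?c z s] c assms(2) by auto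
  then show "\<And>s. s \<notin> T \<Longrightarrow> hat z s = 0" by simp
  have "sum (hat z) T = sum c T" by (rule sum.cong) (auto simp: *)
  with c show "sum (hat z) T = 1" by simp
  have "(\<Sum>t\<in>T. c t *\<^sub>R lat t) = (\<Sum>t\<in>T. hat z t *\<^sub>R lat t)" by (rule sum.cong) (auto simp: *)
  with c show "z = (\<Sum>s\<in>T. hat z s *\<^sub>R lat s)" by simp
qed

lemma hat_nonneg [simp]: "0 \<le> hat z s"
  by (simp add: hat_def)

lemmas hat_cell = hat_face[OF _ subset_refl]

text \<open>The integer parts select a unit parallelogram of the lattice, which the diagonal
  \<open>x + y = 1\<close> splits into an upward and a downward cell.\<close>

lemma rtri_cover: "z \<in> rtri (up (\<lfloor>cX z\<rfloor>, \<lfloor>cY z\<rfloor>)) \<or> z \<in> rtri (down (\<lfloor>cX z\<rfloor>, \<lfloor>cY z\<rfloor>))"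
proof -
  define m n where "m = \<lfloor>cX z\<rfloor>" "n = \<lfloor>cY z\<rfloor>"
  define x y where "x = cX z - of_int m" "y = cY z - of_int n"
  have xy: "0 \<le> x" "x \<le> 1" "0 \<le> y" "y \<le> 1" unfolding x_y_def m_n_def by linarith+
  show ?thesis
  proof (cases "x + y \<le> 1")
    case True
    let ?c = "\<lambda>s. if s = (m,n) then 1 - x - y else if s = (m+1,n) then x else y"
    have "z = (\<Sum>s\<in>up (m,n). ?c s *\<^sub>R lat s)" "sum ?c (up (m,n)) = 1"
      by (auto simp: sum_up x_y_def algebra_simps intro!: complex_eqI_XY)
    moreover have "\<forall>s\<in>up (m,n). 0 \<le> ?c s" using xy True by auto
    ultimately have "z \<in> rtri (up (m,n))"
      unfolding rtri_def by (subst convex_hull_image_explicit) (auto simp: up_def intro!: exI[of _ ?c])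
    then show ?thesis by (simp add: m_n_def)
  next
    case False
    let ?c = "\<lambda>s. if s = (m+1,n+1) then x + y - 1 else if s = (m+1,n) then 1 - y else 1 - x"
    have "z = (\<Sum>s\<in>down (m,n). ?c s *\<^sub>R lat s)" "sum ?c (down (m,n)) = 1"
      by (auto simp: sum_down x_y_def algebra_simps intro!: complex_eqI_XY)
    moreover have "\<forall>s\<in>down (m,n). 0 \<le> ?c s" using xy False by auto
    ultimately have "z \<in> rtri (down (m,n))"
      unfolding rtri_def by (subst convex_hull_image_explicit) (auto simp: down_def intro!: exI[of _ ?c])
    then show ?thesis by (simp add: m_n_def)
  qed
qed

text \<open>A common point has the same tents whichever cell it is viewed in. They vanish off
  \<open>T\<close> and off \<open>T'\<close>, so its barycentric combination lives on the common
  vertices.\<close>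

lemma rtri_Int:
  assumes "S \<in> cells" "T \<subseteq> S" "S' \<in> cells" "T' \<subseteq> S'"
  shows "rtri T \<inter> rtri T' = rtri (T \<inter> T')"
proof
  show "rtri (T \<inter> T') \<subseteq> rtri T \<inter> rtri T'"
    unfolding rtri_def by (intro Int_greatest hull_mono) auto
  have fin: "finite T" using assms finite_cell finite_subset by blast
  show "rtri T \<inter> rtri T' \<subseteq> rtri (T \<inter> T')"
  proof
    fix z assume z: "z \<in> rtri T \<inter> rtri T'"
    have 0: "hat z s = 0" if "s \<in> T - T \<inter> T'" for s
      using hat_face(1)[OF assms(3,4)] z that by blast
    have "sum (hat z) (T \<inter> T') = sum (hat z) T"
      using 0 fin by (intro sum.mono_neutral_left) auto
    moreover have "(\<Sum>s\<in>T \<inter> T'. hat z s *\<^sub>R lat s) = (\<Sum>s\<in>T. hat z s *\<^sub>R lat s)"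
      using 0 fin by (intro sum.mono_neutral_left) auto
    moreover have "finite (T \<inter> T')" using fin by simp
    ultimately show "z \<in> rtri (T \<inter> T')"
      using hat_face(2,3)[OF assms(1,2), of z] z unfolding rtri_def
      by (subst convex_hull_image_explicit) (auto intro!: exI[of _ "hat z"])
  qed
qed

lemma hat_lat [simp]: "hat (lat v) v = 1"
  using cX_scaleR[of 0 0] cY_scaleR[of 0 0] by (simp add: hat_def hexnorm_def)

lemma lat_mem_rtri_iff: "S \<in> cells \<Longrightarrow> lat v \<in> rtri S \<longleftrightarrow> v \<in> S"
  using hat_cell(1)[of S "lat v" v] by (auto simp: rtri_def hull_inc)

section \<open>The folding map\<close>

text \<open>The primitive cube root of unity with argument -2 pi / 3; its square is the
  counterclockwise third of a turn.\<close>

definition kap :: complex where "kap = - om"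

text \<open>The 3-colouring of the lattice. Taking cube roots of unity as colours makes it a
  homomorphism and lets a colour serve as the linear part of a rotation.\<close>

definition e3 :: "int \<times> int \<Rightarrow> complex" where
  "e3 v = kap powi (fst v - snd v)"

text \<open>\<open>fold_map\<close> folds the plane onto one triangle, mapping each cell isometrically;
  \<open>chi\<close> is its restriction to the lattice, with values \<open>0\<close>, \<open>1\<close> and \<open>cnj om\<close> according to the class of \<open>m - n\<close> modulo 3.\<close>

definition chi :: "int \<times> int \<Rightarrow> complex" where
  "chi v = (1 - e3 v) / (1 - kap)"

definition fold_map :: "complex \<Rightarrow> complex" where
  "fold_map z = (\<Sum>v | hat z v \<noteq> 0. hat z v *\<^sub>R chi v)"

lemma kap_cube: "kap ^ 3 = 1"
  by (simp add: kap_def complex_eq_iff power3_eq_cube)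

lemma kap_nz [simp]: "kap \<noteq> 0"
  by (simp add: kap_def)

lemma norm_kap [simp]: "norm kap = 1"
  by (simp add: kap_def)

lemma kap_ne_1: "1 - kap \<noteq> 0"
  by (simp add: kap_def complex_eq_iff)

lemma norm_e3 [simp]: "norm (e3 v) = 1"
  by (simp add: e3_def norm_power_int)

lemma e3_nz [simp]: "e3 v \<noteq> 0"
  by (simp add: e3_def)

lemma e3_add: "e3 (v + w) = e3 v * e3 w"
  by (simp add: e3_def power_int_add[symmetric] algebra_simps)

lemma e3_zero [simp]: "e3 0 = 1"
  by (simp add: e3_def)

lemma e3_10 [simp]: "e3 (1, 0) = - om" and e3_01 [simp]: "e3 (0, 1) = - cnj om"
  and e3_11 [simp]: "e3 (1, 1) = 1"
proof -
  have "inverse kap = - cnj om"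
    by (rule inverse_unique) (simp add: kap_def complex_eq_iff)
  then show "e3 (0, 1) = - cnj om" by (simp add: e3_def power_int_minus)
qed (simp_all add: e3_def kap_def)

lemma e3_eq_mod: "e3 v = kap ^ nat ((fst v - snd v) mod 3)"
proof -
  have "kap powi k = kap powi (k mod 3)" for k
  proof -
    have "kap powi k = kap powi (k mod 3 + 3 * (k div 3))" by simp
    also have "\<dots> = kap powi (k mod 3) * (kap powi 3) powi (k div 3)"
      by (simp only: power_int_add power_int_mult kap_nz simp_thms)
    also have "kap powi 3 = 1" using kap_cube by (simp add: power_int_def)
    finally show ?thesis by simp
  qed
  then have "e3 v = kap powi ((fst v - snd v) mod 3)" by (simp add: e3_def)
  also have "\<dots> = kap ^ nat ((fst v - snd v) mod 3)"
    by (simp add: power_int_def)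
  finally show ?thesis .
qed

lemma e3_cases: "e3 v = 1 \<or> e3 v = kap \<or> e3 v = kap\<^sup>2"
proof -
  have "(fst v - snd v) mod 3 = 0 \<or> (fst v - snd v) mod 3 = 1 \<or> (fst v - snd v) mod 3 = 2" by arith
  then show ?thesis by (auto simp: e3_eq_mod)
qed

lemma e3_eq_iff: "e3 v = e3 w \<longleftrightarrow> (fst v - snd v) mod 3 = (fst w - snd w) mod 3"
proof
  have ne: "kap \<noteq> 1" "kap\<^sup>2 \<noteq> 1" "kap\<^sup>2 \<noteq> kap"
    by (simp_all add: kap_def complex_eq_iff power2_eq_square)
  have "(fst u - snd u) mod 3 = 0 \<or> (fst u - snd u) mod 3 = 1 \<or> (fst u - snd u) mod 3 = 2"
    for u :: "int \<times> int" by arith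
  from this[of v] this[of w] show "(fst v - snd v) mod 3 = (fst w - snd w) mod 3" if "e3 v = e3 w"
    using that ne by (auto simp: e3_eq_mod)
qed (simp add: e3_eq_mod)

lemma chi_zero [simp]: "chi 0 = 0"
  by (simp add: chi_def)

text \<open>The cocycle identity: moving the base point to \<open>v\<close> turns the folded
  differences by \<open>e3 v\<close>.\<close>

lemma chi_add: "chi (v + w) = chi v + e3 v * chi w"
  by (simp add: chi_def e3_add algebra_simps flip: add_divide_distrib)

lemma chi_10 [simp]: "chi (1, 0) = 1" and chi_01 [simp]: "chi (0, 1) = cnj om"
  and chi_11 [simp]: "chi (1, 1) = 0"
proof -
  have "1 - e3 (0,1) = cnj om * (1 - kap)" by (simp add: kap_def complex_eq_iff)
  then show "chi (0, 1) = cnj om" by (simp only: chi_def nonzero_mult_div_cancel_right[OF kap_ne_1])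
qed (use kap_ne_1 in \<open>simp_all add: chi_def, simp add: kap_def\<close>)

lemma lat_10 [simp]: "lat (1, 0) = 1" and lat_01 [simp]: "lat (0, 1) = om"
  and lat_11 [simp]: "lat (1, 1) = 1 + om"
  by (simp_all add: lat_def)

lemma norm_equilateral_combination:
  fixes x y :: complex
  assumes "norm x = 1" "norm y = 1" "norm (y - x) = 1"
  shows "(norm (b *\<^sub>R x + c *\<^sub>R y))\<^sup>2 = b\<^sup>2 + b * c + c\<^sup>2"
proof -
  have *: "(norm x)\<^sup>2 = 1" "(norm y)\<^sup>2 = 1" "(norm (y - x))\<^sup>2 = 1" using assms by simp_all
  then have "x \<bullet> y = 1/2"
    by (simp add: power2_norm_eq_inner inner_diff inner_commute)
  moreover have "x \<bullet> x = 1" "y \<bullet> y = 1" using * by (simp_all add: power2_norm_eq_inner)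
  ultimately show ?thesis
    unfolding power2_norm_eq_inner
    by (simp add: inner_add inner_commute power2_eq_square algebra_simps)
qed

lemma norm_om_diff [simp]: "norm (om - 1) = 1" "norm (1 - om) = 1" "norm (cnj om - 1) = 1"
  by (simp_all add: cmod_def power2_eq_square)

text \<open>Both \<open>lat\<close> and \<open>chi\<close> send the vertices of a cell to a unit
  equilateral triangle, so both squared norms equal the same positive definite form in two of the
  coefficients. Coefficients of sum 0 describe difference vectors: the first part makes the fold
  isometric on a cell, the second says that the cell is nondegenerate.\<close>

lemma norm_combination:
  assumes "S \<in> cells" "sum c S = 0"
  shows "norm (\<Sum>s\<in>S. c s *\<^sub>R chi s) = norm (\<Sum>s\<in>S. c s *\<^sub>R lat s) \<and>
    ((\<Sum>s\<in>S. c s *\<^sub>R lat s) = 0 \<longrightarrow> (\<forall>s\<in>S. c s = 0))"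
proof -
  have *: ?thesis if "S = {p, q, r}" "p \<noteq> q" "p \<noteq> r" "q \<noteq> r"
    "norm (chi q - chi p) = 1" "norm (chi r - chi p) = 1" "norm (chi r - chi q) = 1"
    "norm (lat q - lat p) = 1" "norm (lat r - lat p) = 1" "norm (lat r - lat q) = 1" for p q r
  proof -
    have cp: "c p = - c q - c r" using assms(2) that by simp
    let ?f = "(c q)\<^sup>2 + c q * c r + (c r)\<^sup>2"
    have "(\<Sum>s\<in>S. c s *\<^sub>R chi s) = c q *\<^sub>R (chi q - chi p) + c r *\<^sub>R (chi r - chi p)"
      using that by (simp add: cp algebra_simps)
    then have 1: "(norm (\<Sum>s\<in>S. c s *\<^sub>R chi s))\<^sup>2 = ?f"
      using norm_equilateral_combination that by simp
    have "(\<Sum>s\<in>S. c s *\<^sub>R lat s) = c q *\<^sub>R (lat q - lat p) + c r *\<^sub>R (lat r - lat p)"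
      using that by (simp add: cp algebra_simps)
    then have 2: "(norm (\<Sum>s\<in>S. c s *\<^sub>R lat s))\<^sup>2 = ?f"
      using norm_equilateral_combination that by simp
    have "c q = 0 \<and> c r = 0" if "?f = 0"
    proof -
      have "(c q + c r / 2)\<^sup>2 + 3/4 * (c r)\<^sup>2 = 0"
        using that by (simp add: power2_eq_square algebra_simps)
      moreover have "(c q + c r / 2)\<^sup>2 \<ge> 0" "(c r)\<^sup>2 \<ge> 0" by simp_all
      ultimately have "(c q + c r / 2)\<^sup>2 = 0" "(c r)\<^sup>2 = 0" by linarith+
      then show ?thesis by simp
    qed
    moreover have "norm (\<Sum>s\<in>S. c s *\<^sub>R chi s) = norm (\<Sum>s\<in>S. c s *\<^sub>R lat s)"
      by (rule power2_eq_imp_eq) (simp_all add: 1 2)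
    moreover have "?f = 0" if "(\<Sum>s\<in>S. c s *\<^sub>R lat s) = 0"
      using 2 unfolding that by simp
    ultimately show ?thesis using cp unfolding that(1) by auto
  qed
  have u: "norm (e3 v * cnj om - e3 v) = 1" for v
    using norm_mult[of "e3 v" "cnj om - 1"] by (simp add: algebra_simps)
  have d: "v \<noteq> v + (1,0)" "v \<noteq> v + (0,1)" "v + (1,0) \<noteq> v + (0,1)" "v + (1,1) \<noteq> v + (1,0)"
    "v + (1,1) \<noteq> v + (0,1)" for v :: "int \<times> int"
    by (simp_all add: prod_eq_iff)
  from assms(1) show ?thesis unfolding cells_def
  proof
    assume "S \<in> range up"
    then obtain v where v: "S = up v" by auto
    show ?thesis
    proof (rule * [OF v[unfolded up_def] d(1,2,3)])
    qed (simp_all add: chi_add lat_add norm_mult u)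
  next
    assume "S \<in> range down"
    then obtain v where v: "S = down v" by auto
    then have "S = {v + (1,1), v + (1,0), v + (0,1)}" by (auto simp: down_def)
    from * [OF this d(4,5,3)] show ?thesis
      by (simp add: chi_add lat_add norm_mult u)
  qed
qed

lemma fold_map_cell:
  assumes "S \<in> cells" "z \<in> rtri S"
  shows "fold_map z = (\<Sum>s\<in>S. hat z s *\<^sub>R chi s)"
  unfolding fold_map_def using hat_cell(1)[OF assms] finite_cell[OF assms(1)]
  by (intro sum.mono_neutral_left) auto

lemma fold_map_cell_isometry:
  assumes "S \<in> cells" "z \<in> rtri S" "w \<in> rtri S"
  shows "norm (fold_map z - fold_map w) = norm (z - w)"
proof -
  let ?c = "\<lambda>s. hat z s - hat w s"
  have 1: "fold_map z - fold_map w = (\<Sum>s\<in>S. ?c s *\<^sub>R chi s)"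
    using assms by (simp add: fold_map_cell scaleR_diff_left sum_subtractf)
  have 2: "z - w = (\<Sum>s\<in>S. ?c s *\<^sub>R lat s)"
    unfolding scaleR_diff_left sum_subtractf
    by (rule arg_cong2[where f = minus, OF hat_cell(3)[OF assms(1,2)] hat_cell(3)[OF assms(1,3)]])
  have 3: "sum ?c S = 0"
    using hat_cell(2)[OF assms(1,2)] hat_cell(2)[OF assms(1,3)] by (simp add: sum_subtractf)
  show ?thesis
    unfolding 1 2 by (rule conjunct1[OF norm_combination[OF assms(1) 3]])
qed

lemma closed_rtri: "S \<in> cells \<Longrightarrow> closed (rtri S)"
  unfolding rtri_def by (simp add: finite_cell compact_imp_closed finite_imp_compact_convex_hull)

text \<open>The segment from \<open>z\<close> to \<open>w\<close> is covered by finitely many closed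
  cells, on each of which the fold is an isometry. The bounds with common constant
  \<open>norm (z - w)\<close> combine along the parameter interval, and its end points give the
  claim.\<close>

lemma fold_map_lipschitz: "norm (fold_map z - fold_map w) \<le> norm (z - w)"
proof -
  define p where "p = (\<lambda>t::real. z + t *\<^sub>R (w - z))"
  \<comment> \<open>\<open>M\<close> bounds both lattice coordinates along the whole segment, so the
    finitely many cells with base point in \<open>B\<close> cover it.\<close>
  define M where "M = \<bar>cX z\<bar> + \<bar>cY z\<bar> + \<bar>cX w\<bar> + \<bar>cY w\<bar>"
  define B where "B = {\<lfloor>- M\<rfloor>..\<lfloor>M\<rfloor>} \<times> {\<lfloor>- M\<rfloor>..\<lfloor>M\<rfloor>}"
  define I where "I = up ` B \<union> down ` B"
  have I: "I \<subseteq> cells" by (auto simp: I_def cells_def)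
  have cont: "continuous_on UNIV p" unfolding p_def by (intro continuous_intros)
  have dp: "norm (p s - p t) = norm (z - w) * \<bar>s - t\<bar>" for s t
  proof -
    have "p s - p t = (s - t) *\<^sub>R (w - z)" by (simp add: p_def algebra_simps)
    then show ?thesis by (simp add: norm_minus_commute)
  qed
  have "lipschitz_on (norm (z - w)) {0..1} (\<lambda>t. fold_map (p t))"
  proof (rule lipschitz_on_closed_Union[where U = "\<lambda>S. p -` rtri S" and I = I])
    fix S assume "S \<in> I"
    then have S: "S \<in> cells" using I by auto
    show "lipschitz_on (norm (z - w)) (p -` rtri S) (\<lambda>t. fold_map (p t))"
      by (rule lipschitz_onI)
        (auto simp: dist_norm fold_map_cell_isometry[OF S] dp)
    show "closed (p -` rtri S)"
      using closed_rtri[OF S] cont by (simp add: continuous_closed_vimage continuous_on_eq_continuous_at)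
  next
    show "finite I" by (simp add: I_def B_def)
    show "{0..1} \<subseteq> (\<Union>S\<in>I. p -` rtri S)"
    proof
      fix t :: real assume t: "t \<in> {0..1}"
      have b: "\<bar>a + t * (b - a)\<bar> \<le> \<bar>a\<bar> + \<bar>b\<bar>" for a b :: real
      proof -
        have "\<bar>a + t * (b - a)\<bar> = \<bar>(1 - t) * a + t * b\<bar>" by (simp add: algebra_simps)
        also have "\<dots> \<le> (1 - t) * \<bar>a\<bar> + t * \<bar>b\<bar>"
          using t by (intro order_trans[OF abs_triangle_ineq]) (simp add: abs_mult)
        also have "\<dots> \<le> \<bar>a\<bar> + \<bar>b\<bar>"
          using t by (intro add_mono mult_left_le_one_le) auto
        finally show ?thesis .
      qed
      have "\<bar>cX (p t)\<bar> \<le> M" "\<bar>cY (p t)\<bar> \<le> M"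
        using b[of "cX z" "cX w"] b[of "cY z" "cY w"] unfolding p_def M_def cX_add cY_add cX_scaleR cY_scaleR cX_diff cY_diff by linarith+
      then have "(\<lfloor>cX (p t)\<rfloor>, \<lfloor>cY (p t)\<rfloor>) \<in> B"
        by (auto simp: B_def abs_le_iff intro!: floor_mono)
      then show "t \<in> (\<Union>S\<in>I. p -` rtri S)"
        using rtri_cover[of "p t"] by (auto simp: I_def)
    qed
  qed simp
  from lipschitz_onD[OF this, of 0 1] show ?thesis by (simp add: p_def dist_norm)
qed

lemma ex_cell: "\<exists>S\<in>cells. z \<in> rtri S"
  using rtri_cover[of z] by (auto simp: cells_def)

lemma fold_map_lat [simp]: "fold_map (lat v) = chi v"
proof -
  have S: "up v \<in> cells" "v \<in> up v" by (auto simp: cells_def up_def)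
  have lv: "lat v \<in> rtri (up v)" using S by (simp add: lat_mem_rtri_iff)
  have z: "hat (lat v) s = 0" if "s \<in> up v - {v}" for s
  proof -
    have "sum (hat (lat v)) (up v) = 1 + sum (hat (lat v)) (up v - {v})"
      using S by (subst sum.remove[of _ v]) (auto simp: finite_cell)
    then have "sum (hat (lat v)) (up v - {v}) = 0" using hat_cell(2)[OF S(1) lv] by simp
    then show ?thesis
      using that by (subst (asm) sum_nonneg_eq_0_iff) (auto simp: up_def)
  qed
  have "fold_map (lat v) = (\<Sum>s\<in>{v}. hat (lat v) s *\<^sub>R chi s)"
    unfolding fold_map_cell[OF S(1) lv] using z S
    by (intro sum.mono_neutral_right) (auto simp: finite_cell)
  then show ?thesis by simp
qed

lemma cells_containing:
  "{S \<in> cells. v \<in> S} = {up v, up (v - (1,0)), up (v - (0,1)),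
     down (v - (1,0)), down (v - (0,1)), down (v - (1,1))}"
proof -
  have "(\<exists>w. S = up w \<and> v \<in> up w) \<longleftrightarrow> S \<in> {up v, up (v - (1,0)), up (v - (0,1))}" for S
  proof -
    have "v \<in> up w \<longleftrightarrow> w = v \<or> w = v - (1,0) \<or> w = v - (0,1)" for w
      by (auto simp: up_def)
    then show ?thesis by (simp del: split_paired_Ex) blast
  qed
  moreover have "(\<exists>w. S = down w \<and> v \<in> down w) \<longleftrightarrow>
      S \<in> {down (v - (1,0)), down (v - (0,1)), down (v - (1,1))}" for S
  proof -
    have "v \<in> down w \<longleftrightarrow> w = v - (1,0) \<or> w = v - (0,1) \<or> w = v - (1,1)" for w
      by (auto simp: down_def)
    then show ?thesis by (simp del: split_paired_Ex) blast
  qed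
  moreover have "S \<in> cells \<and> v \<in> S \<longleftrightarrow> (\<exists>w. S = up w \<and> v \<in> up w) \<or> (\<exists>w. S = down w \<and> v \<in> down w)" for S
    unfolding cells_def by blast
  ultimately have "S \<in> cells \<and> v \<in> S \<longleftrightarrow> S \<in> {up v, up (v - (1,0)), up (v - (0,1))} \<union>
      {down (v - (1,0)), down (v - (0,1)), down (v - (1,1))}" for S
    unfolding Un_iff by presburger
  then show ?thesis by (simp only: set_eq_iff mem_Collect_eq Un_insert_left Un_empty_left simp_thms)
qed

section \<open>The deformed tiling and the homeomorphism onto it\<close>

locale folded_tiling =
  fixes beta Q :: complex
  assumes norm_less: "norm Q < norm beta"
begin

definition V :: "int \<times> int \<Rightarrow> complex" where
  "V v = beta * lat v + Q * chi v"

definition Phi :: "complex \<Rightarrow> complex" where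
  "Phi z = beta * z + Q * fold_map z"

definition tri :: "(int \<times> int) set \<Rightarrow> complex set" where
  "tri S = convex hull (V ` S)"

lemma Phi_lat [simp]: "Phi (lat v) = V v"
  by (simp add: Phi_def V_def)

text \<open>\<open>Phi\<close> differs from the similarity with factor \<open>beta\<close> by a map
  of Lipschitz constant \<open>norm Q\<close>; the upper and lower distance estimates both come from
  this.\<close>

lemma Phi_diff: "norm (Phi z - Phi w - beta * (z - w)) \<le> norm Q * norm (z - w)"
proof -
  have "Phi z - Phi w - beta * (z - w) = Q * (fold_map z - fold_map w)"
    by (simp add: Phi_def algebra_simps)
  then show ?thesis by (simp add: norm_mult mult_left_mono fold_map_lipschitz)
qed

lemma Phi_upper: "norm (Phi z - Phi w) \<le> (norm beta + norm Q) * norm (z - w)"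
  using Phi_diff[of z w] norm_triangle_sub[of "Phi z - Phi w" "beta * (z - w)"]
  unfolding norm_mult distrib_right by linarith

lemma Phi_lower: "(norm beta - norm Q) * norm (z - w) \<le> norm (Phi z - Phi w)"
proof -
  have "norm (beta * (z - w)) \<le> norm (Phi z - Phi w) + norm (beta * (z - w) - (Phi z - Phi w))"
    by (rule norm_triangle_sub)
  then show ?thesis using Phi_diff[of z w]
    unfolding norm_mult left_diff_distrib norm_minus_commute[of "beta * (z - w)"] by linarith
qed

lemma inj_Phi: "inj Phi"
proof
  fix z w assume "Phi z = Phi w"
  then have "(norm beta - norm Q) * norm (z - w) \<le> 0" using Phi_lower[of z w] by simp
  then have "norm (z - w) \<le> 0" using norm_less by (simp add: mult_le_0_iff)
  then show "z = w" by simp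
qed

text \<open>Solving \<open>Phi z = y\<close> is a fixed point problem for the contraction
  \<open>z \<mapsto> (y - Q * fold_map z) / beta\<close>.\<close>

lemma surj_Phi: "surj Phi"
  unfolding surj_def
proof
  fix y
  have b: "beta \<noteq> 0" using norm_less by auto
  have "\<exists>!z. (y - Q * fold_map z) / beta = z"
  proof (rule banach_fix_type)
    show "0 \<le> norm Q / norm beta" "norm Q / norm beta < 1" using norm_less b by auto
    show "\<forall>z w. dist ((y - Q * fold_map z) / beta) ((y - Q * fold_map w) / beta)
       \<le> norm Q / norm beta * dist z w"
    proof (intro allI)
      fix z w
      have "(y - Q * fold_map z) / beta - (y - Q * fold_map w) / beta
          = Q * (fold_map w - fold_map z) / beta"
        by (simp add: algebra_simps flip: diff_divide_distrib)
      then have "dist ((y - Q * fold_map z) / beta) ((y - Q * fold_map w) / beta)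
        = norm Q / norm beta * norm (fold_map w - fold_map z)"
        by (simp add: dist_norm norm_mult norm_divide)
      also have "\<dots> \<le> norm Q / norm beta * norm (w - z)"
        by (intro mult_left_mono fold_map_lipschitz) auto
      finally show "dist ((y - Q * fold_map z) / beta) ((y - Q * fold_map w) / beta)
       \<le> norm Q / norm beta * dist z w" by (simp add: dist_norm norm_minus_commute)
    qed
  qed
  then obtain z where "(y - Q * fold_map z) / beta = z" by blast
  then have "y = Phi z" using b by (simp add: Phi_def field_simps)
  then show "\<exists>z. y = Phi z" ..
qed

lemma bij_Phi: "bij Phi"
  by (simp add: bij_def inj_Phi surj_Phi)

lemma lipschitz_Phi: "lipschitz_on (norm beta + norm Q) UNIV Phi"
  by (rule lipschitz_onI) (auto simp: dist_norm Phi_upper)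

lemma lipschitz_inv_Phi: "lipschitz_on (1 / (norm beta - norm Q)) UNIV (inv_into UNIV Phi)"
proof (rule lipschitz_onI)
  fix x y
  show "dist (inv_into UNIV Phi x) (inv_into UNIV Phi y) \<le> 1 / (norm beta - norm Q) * dist x y"
    using Phi_lower[of "inv_into UNIV Phi x" "inv_into UNIV Phi y"] norm_less
    by (simp add: surj_f_inv_f[OF surj_Phi] dist_norm field_simps)
qed (use norm_less in simp)

lemma continuous_on_Phi: "continuous_on S Phi" and continuous_on_inv_Phi: "continuous_on S (inv_into UNIV Phi)"
  using lipschitz_on_continuous_on[OF lipschitz_Phi] lipschitz_on_continuous_on[OF lipschitz_inv_Phi]
  by (auto intro: continuous_on_subset)

lemma Phi_image_eq_vimage: "Phi ` X = inv_into UNIV Phi -` X"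
  by (simp add: bij_vimage_eq_inv_image bij_imp_bij_inv bij_Phi inv_inv_eq)

lemma open_Phi_image: "open X \<Longrightarrow> open (Phi ` X)"
  unfolding Phi_image_eq_vimage by (rule open_vimage[OF _ continuous_on_inv_Phi])

lemma open_Phi_vimage: "open X \<Longrightarrow> open (Phi -` X)"
  by (rule open_vimage[OF _ continuous_on_Phi])

lemma interior_Phi_image: "interior (Phi ` X) = Phi ` interior X"
proof (rule interior_unique)
  show "Phi ` interior X \<subseteq> Phi ` X" using interior_subset by blast
  show "open (Phi ` interior X)" by (simp add: open_Phi_image)
  fix T assume T: "T \<subseteq> Phi ` X" "open T"
  then have "Phi -` T \<subseteq> X" using inj_Phi by (auto dest: injD)
  then have "Phi -` T \<subseteq> interior X" using T by (simp add: interior_maximal open_Phi_vimage)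
  then show "T \<subseteq> Phi ` interior X" using surj_Phi by (metis image_mono surj_image_vimage_eq)
qed

lemma bounded_Phi_image_iff: "bounded (Phi ` X) \<longleftrightarrow> bounded X"
proof
  show "bounded X \<Longrightarrow> bounded (Phi ` X)"
    using lipschitz_Phi lipschitz_on_subset bounded_uniformly_continuous_image
      lipschitz_on_uniformly_continuous by blast
  assume "bounded (Phi ` X)"
  then have "bounded (inv_into UNIV Phi ` Phi ` X)"
    using lipschitz_inv_Phi lipschitz_on_subset bounded_uniformly_continuous_image
      lipschitz_on_uniformly_continuous by blast
  then show "bounded X" by (simp add: image_inv_f_f inj_Phi)
qed

lemma connected_component_set_Phi:
  "connected_component_set (Phi ` X) (Phi x) = Phi ` connected_component_set X x"
proof (cases "x \<in> X")
  case True
  show ?thesis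
  proof
    show "Phi ` connected_component_set X x \<subseteq> connected_component_set (Phi ` X) (Phi x)"
    proof (rule connected_component_maximal)
      show "Phi x \<in> Phi ` connected_component_set X x" using True by simp
      show "connected (Phi ` connected_component_set X x)"
        by (intro connected_continuous_image continuous_on_Phi) simp
      show "Phi ` connected_component_set X x \<subseteq> Phi ` X"
        by (intro image_mono connected_component_subset)
    qed
    have "inv_into UNIV Phi ` connected_component_set (Phi ` X) (Phi x) \<subseteq> connected_component_set X x"
    proof (rule connected_component_maximal)
      have "Phi x \<in> connected_component_set (Phi ` X) (Phi x)" using True by simp
      then show "x \<in> inv_into UNIV Phi ` connected_component_set (Phi ` X) (Phi x)"
        by (metis image_eqI inj_Phi inv_f_f)
      show "connected (inv_into UNIV Phi ` connected_component_set (Phi ` X) (Phi x))"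
        by (intro connected_continuous_image continuous_on_inv_Phi) simp
      have "inv_into UNIV Phi ` connected_component_set (Phi ` X) (Phi x) \<subseteq> inv_into UNIV Phi ` Phi ` X"
        by (intro image_mono connected_component_subset)
      then show "inv_into UNIV Phi ` connected_component_set (Phi ` X) (Phi x) \<subseteq> X"
        by (simp add: image_inv_f_f inj_Phi)
    qed
    then show "connected_component_set (Phi ` X) (Phi x) \<subseteq> Phi ` connected_component_set X x"
      by (metis image_mono image_f_inv_f surj_Phi)
  qed
next
  case False
  then have "Phi x \<notin> Phi ` X" using inj_Phi by (auto dest: injD)
  with False show ?thesis by (simp add: connected_component_eq_empty[THEN iffD2])
qed

text \<open>\<open>inside\<close> is defined through components of the complement and boundedness. A
  homeomorphism of the plane preserves the former, and one that is Lipschitz in both directions the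
  latter.\<close>

lemma inside_Phi_image: "inside (Phi ` X) = Phi ` inside X"
proof -
  have c: "- Phi ` X = Phi ` (- X)" by (simp add: bij_Phi bij_image_Compl_eq)
  have *: "Phi x \<in> inside (Phi ` X) \<longleftrightarrow> x \<in> inside X" for x
    unfolding inside_def c using inj_Phi
    by (simp add: connected_component_set_Phi bounded_Phi_image_iff inj_image_mem_iff)
  show ?thesis
  proof (rule Set.set_eqI)
    fix y
    obtain x where "y = Phi x" using surj_Phi by blast
    then show "y \<in> inside (Phi ` X) \<longleftrightarrow> y \<in> Phi ` inside X"
      using * by (simp only: inj_image_mem_iff[OF inj_Phi])
  qed
qed

text \<open>Within one cell the identity and the fold are both affine in the tents, hence so is
  \<open>Phi\<close>: a deformed tile inherits the barycentric coordinates of the regular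
  one.\<close>

lemma Phi_combination:
  assumes "S \<in> cells" "\<forall>s\<in>S. 0 \<le> c s" "sum c S = 1"
  shows "Phi (\<Sum>s\<in>S. c s *\<^sub>R lat s) = (\<Sum>s\<in>S. c s *\<^sub>R V s)"
proof -
  let ?z = "\<Sum>s\<in>S. c s *\<^sub>R lat s"
  have z: "?z \<in> rtri S" unfolding rtri_def using assms finite_cell
    by (subst convex_hull_image_explicit) auto
  have "fold_map ?z = (\<Sum>s\<in>S. hat ?z s *\<^sub>R chi s)" using fold_map_cell[OF assms(1) z] .
  also have "\<dots> = (\<Sum>s\<in>S. c s *\<^sub>R chi s)"
    by (intro sum.cong refl) (simp add: hat_combination[OF assms refl])
  finally have "Phi ?z = beta * ?z + Q * (\<Sum>s\<in>S. c s *\<^sub>R chi s)" by (simp add: Phi_def)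
  also have "\<dots> = (\<Sum>s\<in>S. c s *\<^sub>R V s)"
    by (simp add: V_def sum_distrib_left scaleR_add_right sum.distrib)
  finally show ?thesis .
qed

lemma Phi_rtri:
  assumes "S \<in> cells" "T \<subseteq> S"
  shows "Phi ` rtri T = tri T"
proof -
  have fin: "finite S" "finite T" using assms finite_cell finite_subset by blast+
  have *: "Phi (\<Sum>s\<in>T. c s *\<^sub>R lat s) = (\<Sum>s\<in>T. c s *\<^sub>R V s)"
    if "\<forall>s\<in>T. 0 \<le> c s" "sum c T = 1" for c
  proof -
    let ?c = "\<lambda>s. if s \<in> T then c s else 0"
    have e: "(\<Sum>s\<in>S. ?c s *\<^sub>R f s) = (\<Sum>s\<in>T. c s *\<^sub>R f s)" for f :: "int \<times> int \<Rightarrow> complex"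
      using assms fin by (intro sum.mono_neutral_cong_right) auto
    have "sum ?c S = sum c T"
      using assms fin by (intro sum.mono_neutral_cong_right) auto
    then show ?thesis using Phi_combination[OF assms(1), of ?c] that by (simp add: e)
  qed
  show ?thesis
    unfolding rtri_def tri_def convex_hull_image_explicit[OF fin(2)] using *
    by (force simp: image_def)
qed

lemma Phi_rtri_cell: "S \<in> cells \<Longrightarrow> Phi ` rtri S = tri S"
  by (simp add: Phi_rtri)

lemma inj_V: "inj V"
proof
  fix v w assume "V v = V w"
  then show "v = w" using inj_Phi inj_lat by (metis Phi_lat injD)
qed

lemma V_mem_tri_iff: "S \<in> cells \<Longrightarrow> V v \<in> tri S \<longleftrightarrow> v \<in> S"
  using lat_mem_rtri_iff[of S v]
  by (metis Phi_lat Phi_rtri_cell inj_Phi inj_image_mem_iff)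

lemma tri_eq_iff: "S \<in> cells \<Longrightarrow> S' \<in> cells \<Longrightarrow> tri S = tri S' \<longleftrightarrow> S = S'"
  using V_mem_tri_iff by blast

lemma tri_Int:
  assumes "S \<in> cells" "T \<subseteq> S" "S' \<in> cells" "T' \<subseteq> S'"
  shows "tri T \<inter> tri T' = tri (T \<inter> T')"
proof -
  have "Phi ` (rtri T \<inter> rtri T') = tri T \<inter> tri T'"
    by (simp only: image_Int[OF inj_Phi] Phi_rtri[OF assms(1,2)] Phi_rtri[OF assms(3,4)])
  moreover have "Phi ` (rtri T \<inter> rtri T') = tri (T \<inter> T')"
    unfolding rtri_Int[OF assms] by (rule Phi_rtri[OF assms(1)]) (use assms(2) in blast)
  ultimately show ?thesis by simp
qed

lemmas tri_Int_cells = tri_Int[OF _ subset_refl _ subset_refl]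

lemma tri_cover: "\<exists>S\<in>cells. x \<in> tri S"
proof -
  obtain z where "x = Phi z" using surj_Phi by blast
  then show ?thesis using ex_cell[of z] Phi_rtri_cell by blast
qed

text \<open>A dependence would equate \<open>beta\<close> times a combination of \<open>lat\<close>
  values with \<open>- Q\<close> times the same combination of \<open>chi\<close> values. These
  combinations have equal norm, so \<open>norm Q < norm beta\<close> forces both to vanish, and the
  regular cell would be degenerate.\<close>

lemma affine_independent_V:
  assumes "S \<in> cells"
  shows "\<not> affine_dependent (V ` S)"
proof
  assume "affine_dependent (V ` S)"
  then obtain U where U: "sum U (V ` S) = 0" "\<exists>x\<in>V ` S. U x \<noteq> 0" "(\<Sum>x\<in>V ` S. U x *\<^sub>R x) = 0"
    using affine_dependent_explicit_finite[of "V ` S"] finite_cell[OF assms] by auto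
  define c where "c s = U (V s)" for s
  have inj: "inj_on V S" using inj_V by (rule inj_on_subset) simp
  have c: "sum c S = 0" "\<exists>s\<in>S. c s \<noteq> 0" "(\<Sum>s\<in>S. c s *\<^sub>R V s) = 0"
    using U by (simp_all add: sum.reindex[OF inj] c_def o_def)
  have "(\<Sum>s\<in>S. c s *\<^sub>R V s) = beta * (\<Sum>s\<in>S. c s *\<^sub>R lat s) + Q * (\<Sum>s\<in>S. c s *\<^sub>R chi s)"
    by (simp add: V_def sum_distrib_left scaleR_add_right sum.distrib)
  then have "beta * (\<Sum>s\<in>S. c s *\<^sub>R lat s) = - Q * (\<Sum>s\<in>S. c s *\<^sub>R chi s)"
    using c by (simp add: add_eq_0_iff)
  then have "norm beta * norm (\<Sum>s\<in>S. c s *\<^sub>R lat s) = norm Q * norm (\<Sum>s\<in>S. c s *\<^sub>R lat s)"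
    using norm_combination[OF assms c(1)] by (metis norm_minus_cancel norm_mult)
  then have "(\<Sum>s\<in>S. c s *\<^sub>R lat s) = 0" using norm_less by simp
  then show False using norm_combination[OF assms c(1)] c(2) by blast
qed

lemma simplex_tri: "S \<in> cells \<Longrightarrow> 2 simplex (tri S)"
  unfolding tri_def
  by (intro simplex_convex_hull conjI affine_independent_V)
    (simp_all add: card_image inj_on_subset[OF inj_V] card_cell)

lemma face_tri:
  assumes "S \<in> cells" "S' \<in> cells"
  shows "(tri S \<inter> tri S') face_of tri S"
proof -
  have "convex hull (V ` (S \<inter> S')) face_of convex hull (V ` S)"
    by (rule face_of_convex_hull_affine_independent[THEN iffD2, OF affine_independent_V[OF assms(1)]])
      (intro exI[of _ "V ` (S \<inter> S')"] conjI image_mono Int_lower1 refl)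
  then show ?thesis unfolding tri_Int_cells[OF assms] unfolding tri_def .
qed

lemma extreme_point_of_tri: "S \<in> cells \<Longrightarrow> x extreme_point_of tri S \<longleftrightarrow> x \<in> V ` S"
  unfolding tri_def by (rule extreme_point_of_convex_hull_affine_independent[OF affine_independent_V])

lemma ex_hat_pos: "\<exists>v. hat z v > 0"
proof -
  obtain S where S: "S \<in> cells" "z \<in> rtri S" using ex_cell by blast
  then have "sum (hat z) S = 1" using hat_cell by blast
  then have "\<exists>s\<in>S. hat z s \<noteq> 0" by (metis sum.neutral zero_neq_one)
  then show ?thesis using hat_nonneg by (metis order_le_less)
qed

lemma open_hat_pos: "open {z. hat z v > 0}"
  unfolding hat_def hexnorm_def less_max_iff_disj
  by (intro open_Collect_disj open_Collect_less continuous_intros)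

lemma plane_triangulation_cells: "plane_triangulation (tri ` cells)"
  unfolding plane_triangulation_def
proof (intro conjI ballI)
  show "locally_finite_in euclidean (tri ` cells)"
    unfolding locally_finite_in_def
  proof (intro conjI ballI)
    fix x :: complex
    obtain z where z: "x = Phi z" using surj_Phi by blast
    obtain v where v: "hat z v > 0" using ex_hat_pos by blast
    \<comment> \<open>The image of the open star of \<open>v\<close>; a tile meeting it has
      \<open>V v\<close> as a vertex, which leaves six tiles.\<close>
    let ?U = "Phi ` {z. hat z v > 0}"
    have "{K \<in> tri ` cells. K \<inter> ?U \<noteq> {}} \<subseteq> tri ` {S \<in> cells. v \<in> S}"
    proof
      fix K assume "K \<in> {K \<in> tri ` cells. K \<inter> ?U \<noteq> {}}"
      then obtain S y where S: "S \<in> cells" "K = tri S" "hat y v > 0" "Phi y \<in> tri S" by auto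
      then have "y \<in> rtri S" by (metis Phi_rtri_cell inj_Phi inj_image_mem_iff)
      then have "v \<in> S" using S hat_cell(1)[of S y v] by force
      with S show "K \<in> tri ` {S \<in> cells. v \<in> S}" by blast
    qed
    moreover have "finite (tri ` {S \<in> cells. v \<in> S})" by (simp add: cells_containing)
    ultimately have "finite {K \<in> tri ` cells. K \<inter> ?U \<noteq> {}}" by (rule finite_subset)
    moreover have "openin euclidean ?U" "x \<in> ?U"
      using open_Phi_image[OF open_hat_pos] z v by auto
    ultimately show "\<exists>V. openin euclidean V \<and> x \<in> V \<and> finite {U \<in> tri ` cells. U \<inter> V \<noteq> {}}"
      by blast
  qed simp
  show "\<Union> (tri ` cells) = UNIV" using tri_cover by blast
qed (auto simp: simplex_tri face_tri)

end

section \<open>The symmetry group\<close>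

text \<open>\<open>mulk\<close> is multiplication by \<open>kap\<close> on the lattice, and \<open>act s\<close> is the motion of the regular
  tiling that takes \<open>0\<close> to \<open>s\<close> and preserves the classes of downward cells.\<close>

definition mulk :: "int \<times> int \<Rightarrow> int \<times> int" where
  "mulk v = (snd v, - fst v - snd v)"

definition act :: "int \<times> int \<Rightarrow> int \<times> int \<Rightarrow> int \<times> int" where
  "act s v = s + (mulk ^^ nat ((fst s - snd s) mod 3)) v"

lemma lat_mulk: "lat (mulk v) = kap * lat v"
  by (simp add: lat_def mulk_def kap_def complex_eq_iff algebra_simps)

lemma e3_mulk [simp]: "e3 (mulk v) = e3 v"
proof -
  have "(fst (mulk v) - snd (mulk v)) mod 3 = (fst v - snd v + snd v * 3) mod 3"
    by (simp add: mulk_def algebra_simps)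
  then show ?thesis unfolding e3_eq_iff mod_mult_self1 .
qed

lemma chi_mulk [simp]: "chi (mulk v) = chi v"
  by (simp add: chi_def)

lemma mulk_minus: "mulk (- v) = - mulk v"
  by (simp add: mulk_def prod_eq_iff)

lemma mulk_cube [simp]: "mulk (mulk (mulk v)) = v"
  by (simp add: mulk_def prod_eq_iff)

lemma act_cases:
  obtains "e3 s = 1" "act s = (\<lambda>v. s + v)" | "e3 s = kap" "act s = (\<lambda>v. s + mulk v)"
    | "e3 s = kap\<^sup>2" "act s = (\<lambda>v. s + mulk (mulk v))"
proof -
  have "(fst s - snd s) mod 3 = 0 \<or> (fst s - snd s) mod 3 = 1 \<or> (fst s - snd s) mod 3 = 2" by arith
  then show thesis
    using that by (auto simp: e3_eq_mod act_def fun_eq_iff numeral_2_eq_2)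
qed

lemma e3_act: "e3 (act s v) = e3 s * e3 v"
  by (rule act_cases[of s]) (simp_all add: e3_add)

lemma lat_act: "lat (act s v) = lat s + e3 s * lat v"
  by (rule act_cases[of s]) (simp_all add: lat_add lat_mulk power2_eq_square)

lemma chi_act: "chi (act s v) = chi s + e3 s * chi v"
  by (rule act_cases[of s]) (simp_all add: chi_add)

lemma act_inverse: obtains t where "act t s = 0" "act s t = 0"
proof (rule act_cases[of s])
  assume s: "e3 s = 1" "act s = (\<lambda>v. s + v)"
  have "e3 (- s) * e3 s = 1" by (simp flip: e3_add)
  with s have "e3 (- s) = 1" by simp
  then have "act (- s) s = 0" by (cases rule: act_cases[of "- s"]) (auto simp: kap_def complex_eq_iff power2_eq_square)
  then show thesis using that s by simp
next
  assume s: "e3 s = kap" "act s = (\<lambda>v. s + mulk v)"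
  \<comment> \<open>The inverse motion takes 0 to the preimage of 0 under \<open>s + mulk v\<close>,
    and \<open>mulk\<close> has order 3.\<close>
  let ?t = "- mulk (mulk s)"
  have "e3 ?t * e3 (mulk (mulk s)) = 1" by (simp only: ab_left_minus e3_zero flip: e3_add)
  then have "e3 ?t * kap = 1" by (simp add: s)
  then have "act ?t s = 0" by (cases rule: act_cases[of ?t]) (auto simp: kap_def complex_eq_iff power2_eq_square)
  then show thesis using that s by (simp add: mulk_minus)
next
  assume s: "e3 s = kap\<^sup>2" "act s = (\<lambda>v. s + mulk (mulk v))"
  let ?t = "- mulk s"
  have "e3 ?t * e3 (mulk s) = 1" by (simp only: ab_left_minus e3_zero flip: e3_add)
  then have "e3 ?t * kap\<^sup>2 = 1" by (simp add: s)
  then have "act ?t s = 0" by (cases rule: act_cases[of ?t]) (auto simp: kap_def complex_eq_iff power2_eq_square)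
  then show thesis using that s by (simp add: mulk_minus)
qed

lemma plus_up: "(+) s ` up v = up (s + v)" and plus_down: "(+) s ` down v = down (s + v)"
  by (simp_all add: up_def down_def add.assoc)

lemma mulk_up: "mulk ` up v = up (mulk v - (0,1))"
proof -
  define w where "w = mulk v - (0,1)"
  have "mulk v = w + (0,1)" "mulk (v + (1,0)) = w" "mulk (v + (0,1)) = w + (1,0)"
    by (simp_all add: w_def mulk_def prod_eq_iff)
  then have "mulk ` up v = {w + (0,1), w, w + (1,0)}" by (simp only: up_def image_insert image_empty)
  then show ?thesis unfolding w_def[symmetric] up_def by blast
qed

lemma mulk_down: "mulk ` down v = down (mulk v - (0,2))"
proof -
  define w where "w = mulk v - (0,2)"
  have "mulk (v + (1,0)) = w + (0,1)" "mulk (v + (0,1)) = w + (1,1)" "mulk (v + (1,1)) = w + (1,0)"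
    by (simp_all add: w_def mulk_def prod_eq_iff)
  then have "mulk ` down v = {w + (0,1), w + (1,1), w + (1,0)}" by (simp only: down_def image_insert image_empty)
  then show ?thesis unfolding w_def[symmetric] down_def by blast
qed

lemma e3_02 [simp]: "e3 (0, - 2) = kap\<^sup>2"
  by (simp add: e3_def power_int_def)

lemma e3_diff_02: "e3 (v - (0,2)) = e3 v * kap\<^sup>2"
proof -
  have "v - (0,2) = v + (0,-2)" by (simp add: prod_eq_iff)
  then show ?thesis by (simp only: e3_add e3_02)
qed

lemma kap_pow [simp]: "kap * kap\<^sup>2 = 1" "kap\<^sup>2 * kap = 1"
  using kap_cube by (simp_all add: power2_eq_square power3_eq_cube mult.assoc)

lemma act_up: "\<exists>w. act s ` up v = up w"
proof (rule act_cases[of s])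
  assume "act s = (\<lambda>v. s + v)"
  then have "act s ` up v = (+) s ` up v" by auto
  then have "act s ` up v = up (s + v)" by (simp only: plus_up)
  then show ?thesis ..
next
  assume "act s = (\<lambda>v. s + mulk v)"
  then have "act s ` up v = (+) s ` mulk ` up v" by auto
  then have "act s ` up v = up (s + (mulk v - (0,1)))" by (simp only: mulk_up plus_up)
  then show ?thesis ..
next
  assume "act s = (\<lambda>v. s + mulk (mulk v))"
  then have "act s ` up v = (+) s ` mulk ` mulk ` up v" by auto
  then have "act s ` up v = up (s + (mulk (mulk v - (0,1)) - (0,1)))" by (simp only: mulk_up plus_up)
  then show ?thesis ..
qed

text \<open>The colour of a vertex is multiplied by \<open>e3 s\<close>, but that of a downward cell
  is invariant; this keeps the three kinds of equilateral tiles apart.\<close>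

lemma act_down: "\<exists>w. act s ` down v = down w \<and> e3 w = e3 v"
proof (rule act_cases[of s])
  assume s: "act s = (\<lambda>v. s + v)" "e3 s = 1"
  then have "act s ` down v = (+) s ` down v" by auto
  moreover have "e3 (s + v) = e3 v" using s by (simp add: e3_add)
  ultimately show ?thesis using plus_down by metis
next
  assume s: "act s = (\<lambda>v. s + mulk v)" "e3 s = kap"
  then have "act s ` down v = (+) s ` mulk ` down v" by auto
  then have "act s ` down v = down (s + (mulk v - (0,2)))" by (simp only: mulk_down plus_down)
  moreover have "e3 (s + (mulk v - (0,2))) = e3 v"
    using s by (simp add: e3_add[of s] e3_diff_02 algebra_simps)
  ultimately show ?thesis by blast
next
  assume s: "act s = (\<lambda>v. s + mulk (mulk v))" "e3 s = kap\<^sup>2"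
  then have "act s ` down v = (+) s ` mulk ` mulk ` down v" by auto
  then have "act s ` down v = down (s + (mulk (mulk v - (0,2)) - (0,2)))"
    by (simp only: mulk_down plus_down)
  moreover have "e3 (s + (mulk (mulk v - (0,2)) - (0,2))) = e3 v * (kap\<^sup>2 * kap\<^sup>2 * kap\<^sup>2)"
    by (simp only: e3_add[of s] e3_diff_02 e3_mulk s mult_ac)
  moreover have "kap\<^sup>2 * kap\<^sup>2 * kap\<^sup>2 = 1"
    by (metis kap_pow(1) mult.assoc mult_1_right power2_eq_square)
  ultimately show ?thesis by (metis mult_1_right)
qed

lemma act_cells:
  assumes "S \<in> cells"
  shows "act s ` S \<in> cells"
proof -
  from assms consider v where "S = up v" | v where "S = down v" unfolding cells_def by blast
  then show ?thesis
  proof cases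
    case 1
    then show ?thesis using act_up[of s v] unfolding cells_def by (metis UnI1 rangeI)
  next
    case 2
    then show ?thesis using act_down[of s v] unfolding cells_def by (metis UnI2 rangeI)
  qed
qed

lemma act_act: "act (act s t) v = act s (act t v)"
proof -
  have "lat (act (act s t) v) = lat (act s (act t v))"
    by (simp add: lat_act e3_act algebra_simps)
  then show ?thesis by (rule injD[OF inj_lat])
qed

lemma act_0 [simp]: "act 0 v = v" "act s 0 = s"
proof -
  have "lat (act 0 v) = lat v" "lat (act s 0) = lat s" by (simp_all add: lat_act)
  then show "act 0 v = v" "act s 0 = s" by (auto dest: injD[OF inj_lat])
qed

lemma act_cells_containing: "(`) (act s) ` {S \<in> cells. v \<in> S} = {S \<in> cells. act s v \<in> S}"
proof -
  obtain t where t: "act t s = 0" "act s t = 0" by (rule act_inverse)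
  have ts: "act t (act s v) = v" "act s (act t v) = v" for v
    using t by (simp_all flip: act_act)
  show ?thesis
  proof
    show "(`) (act s) ` {S \<in> cells. v \<in> S} \<subseteq> {S \<in> cells. act s v \<in> S}"
      by (auto intro: act_cells)
    show "{S \<in> cells. act s v \<in> S} \<subseteq> (`) (act s) ` {S \<in> cells. v \<in> S}"
    proof
      fix S assume S: "S \<in> {S \<in> cells. act s v \<in> S}"
      have "S = act s ` act t ` S" by (simp add: image_image ts)
      moreover have "v \<in> act t ` S" using S ts by (metis (mono_tags, lifting) image_eqI mem_Collect_eq)
      moreover have "act t ` S \<in> cells" using S act_cells by simp
      ultimately show "S \<in> (`) (act s) ` {S \<in> cells. v \<in> S}" by blast
    qed
  qed
qed

text \<open>Three rotations carry \<open>up 0\<close> to \<open>up v\<close>, one for each place of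
  the corner 0. As \<open>act s\<close> turns by \<open>e3 s\<close>, the one wanted puts 0 on a
  vertex whose colour is the rotation factor; the colour of \<open>v\<close> decides which vertex
  that is.\<close>

lemma up_eq_act: "\<exists>s. act s ` up 0 = up v"
proof -
  consider "e3 v = 1" | "e3 v = kap" | "e3 v = kap\<^sup>2" using e3_cases by blast
  then show ?thesis
  proof cases
    case 1
    then have "act v = (\<lambda>w. v + w)" by (cases rule: act_cases[of v])
        (auto simp: kap_def complex_eq_iff power2_eq_square)
    then have "act v ` up 0 = up v" by (simp add: up_def)
    then show ?thesis ..
  next
    case 2
    let ?s = "v + (1,0)"
    have "e3 ?s = kap\<^sup>2" using 2 by (simp add: e3_add kap_def power2_eq_square)
    then have "act ?s = (\<lambda>w. ?s + mulk (mulk w))" by (cases rule: act_cases[of ?s])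
        (auto simp: kap_def complex_eq_iff power2_eq_square)
    then have "act ?s ` up 0 = up v" by (auto simp add: up_def mulk_def prod_eq_iff)
    then show ?thesis ..
  next
    case 3
    let ?s = "v + (0,1)"
    have "kap\<^sup>2 * - cnj om = kap" by (simp add: kap_def complex_eq_iff power2_eq_square)
    then have "e3 ?s = kap" using 3 by (simp add: e3_add)
    then have "act ?s = (\<lambda>w. ?s + mulk w)" by (cases rule: act_cases[of ?s])
        (auto simp: kap_def complex_eq_iff power2_eq_square)
    then have "act ?s ` up 0 = up v" by (auto simp add: up_def mulk_def prod_eq_iff)
    then show ?thesis ..
  qed
qed

text \<open>This is why a symmetry of the coloured tiling that preserves a tile fixes its vertices.\<close>

lemma down_Int_up_0:
  assumes "down v \<inter> up 0 = {s}"
  shows "e3 s = (e3 v)\<^sup>2"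
proof -
  obtain m n where v: "v = (m, n)" by (cases v)
  have up0: "up 0 = {(0,0), (1,0), (0,1)}" by (simp add: up_def zero_prod_def)
  have dn: "down v = {(m+1,n), (m,n+1), (m+1,n+1)}" by (simp add: down_def v)
  have "s \<in> {(0,0), (1,0), (0,1)}" "s \<in> {(m+1,n), (m,n+1), (m+1,n+1)}"
    "(0,0) \<in> {(m+1,n), (m,n+1), (m+1,n+1)} \<longrightarrow> (0,0) = s"
    "(1,0) \<in> {(m+1,n), (m,n+1), (m+1,n+1)} \<longrightarrow> (1,0) = s"
    "(0,1) \<in> {(m+1,n), (m,n+1), (m+1,n+1)} \<longrightarrow> (0,1) = s"
    using assms unfolding up0 dn by blast+
  then have "s = (0,0) \<and> v = (-1,-1) \<or> s = (1,0) \<and> v = (1,-1) \<or> s = (0,1) \<and> v = (-1,1)"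
    unfolding v by (cases s) (simp, smt (verit))
  moreover have "(e3 w)\<^sup>2 = e3 (w + w)" for w by (simp add: e3_add power2_eq_square)
  ultimately show ?thesis by (auto simp: e3_eq_iff)
qed

lemma ex_down_Int_up_0:
  assumes "s \<in> up 0"
  shows "\<exists>v. down v \<inter> up 0 = {s}"
proof -
  have up0: "up 0 = {(0,0), (1,0), (0,1)}" by (simp add: up_def zero_prod_def)
  have "down (-1,-1) \<inter> up 0 = {(0,0)}" "down (1,-1) \<inter> up 0 = {(1,0)}" "down (-1,1) \<inter> up 0 = {(0,1)}"
    unfolding up0 by (auto simp: down_def)
  then show ?thesis using assms unfolding up0 by blast
qed

lemma e3_inj_up_0: "s \<in> up 0 \<Longrightarrow> t \<in> up 0 \<Longrightarrow> e3 s = e3 t \<Longrightarrow> s = t"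
  unfolding up_def insert_iff by (elim disjE; simp add: complex_eq_iff)

lemma affine_image_convex_hull:
  fixes a b :: complex
  shows "(\<lambda>z. a * z + b) ` (convex hull X) = convex hull ((\<lambda>z. a * z + b) ` X)"
proof -
  have "linear ((*) a)" by (simp add: linear_times)
  then have "(*) a ` (convex hull X) = convex hull ((*) a ` X)" by (rule convex_hull_linear_image)
  then have "(+) b ` (*) a ` (convex hull X) = convex hull ((+) b ` (*) a ` X)"
    by (simp add: convex_hull_translation)
  then show ?thesis by (simp add: image_image add.commute)
qed

text \<open>Comparing squared distances to two fixed points shows that the displacement
  \<open>f z - z\<close> is orthogonal to their difference. A nonzero displacement would make the
  two sides at \<open>a\<close> parallel.\<close>

lemma isometry_fixing_triangle:
  assumes f: "isometry f" and fx: "f a = a" "f b = b" "f c = c" and "\<not> collinear {a, b, c}"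
  shows "f z = z"
proof -
  define d where "d = f z - z"
  have e: "dist (f z) p = dist z p" if "f p = p" for p
    using f that unfolding isometry_def by metis
  have "(f z - z) \<bullet> (q - p) = 0" if "f p = p" "f q = q" for p q
    using e[OF that(1)] e[OF that(2)]
    by (simp add: dist_norm norm_eq_sqrt_inner inner_diff inner_commute algebra_simps)
  then have d: "d \<bullet> (b - a) = 0" "d \<bullet> (c - a) = 0" using fx by (auto simp: d_def)
  show ?thesis
  proof (rule ccontr)
    assume "f z \<noteq> z"
    then have d0: "d \<noteq> 0" by (simp add: d_def)
    \<comment> \<open>In the plane, the vectors orthogonal to a nonzero \<open>d\<close> are the
      real multiples of its quarter turn.\<close>
    have *: "\<exists>r. x = r *\<^sub>R (\<i> * d)" if "d \<bullet> x = 0" for x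
    proof -
      define n where "n = (Re d)\<^sup>2 + (Im d)\<^sup>2"
      have n: "n \<noteq> 0" using d0 by (simp add: n_def complex_eq_iff sum_power2_eq_zero_iff)
      have o: "Re d * Re x + Im d * Im x = 0" using that by (simp add: inner_complex_def)
      let ?r = "(Re d * Im x - Im d * Re x) / n"
      have "n * Re x = - (Re d * Im x - Im d * Re x) * Im d"
      proof -
        have "n * Re x + (Re d * Im x - Im d * Re x) * Im d = Re d * (Re d * Re x + Im d * Im x)"
          by (simp add: n_def power2_eq_square algebra_simps)
        then show ?thesis
          by (simp only: o mult_zero_right minus_mult_left[symmetric] eq_neg_iff_add_eq_0)
      qed
      moreover have "n * Im x = (Re d * Im x - Im d * Re x) * Re d"
      proof -
        have "n * Im x - (Re d * Im x - Im d * Re x) * Re d = Im d * (Re d * Re x + Im d * Im x)"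
          by (simp add: n_def power2_eq_square algebra_simps)
        then show ?thesis by (simp only: o mult_zero_right right_minus_eq)
      qed
      ultimately have "x = ?r *\<^sub>R (\<i> * d)"
        using n by (simp add: complex_eq_iff field_simps)
      then show ?thesis ..
    qed
    obtain r s where "b - a = r *\<^sub>R (\<i> * d)" "c - a = s *\<^sub>R (\<i> * d)"
      using *[OF d(1)] *[OF d(2)] by blast
    then have "b - a = 0 \<or> (\<exists>k. c - a = k *\<^sub>R (b - a))"
      by (cases "r = 0") (auto intro: exI[of _ "s / r"])
    then have "collinear {0, b - a, c - a}"
      unfolding collinear_lemma by blast
    then have "collinear {b, a, c}"
      by (subst collinear_3) auto
    then show False using assms(5) by (simp add: insert_commute)
  qed
qed

lemma cis_2pi_3: "cis (2 * pi / 3) = kap\<^sup>2"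
proof -
  have "cos (2 * pi / 3) = - cos (pi / 3)" "sin (2 * pi / 3) = sin (pi / 3)"
    using cos_pi_minus[of "pi / 3"] sin_pi_minus[of "pi / 3"] by (simp_all add: field_simps)
  then show ?thesis by (simp add: complex_eq_iff cos_60 sin_60 kap_def power2_eq_square)
qed

lemma kap_sq_ne_1: "1 - kap\<^sup>2 \<noteq> 0"
  by (simp add: kap_def complex_eq_iff power2_eq_square)

section \<open>Motions of the deformed tiling and its coloured symmetries\<close>

context folded_tiling
begin

definition motion :: "int \<times> int \<Rightarrow> complex \<Rightarrow> complex" where
  "motion s z = e3 s * z + V s"

definition T_tiles :: "complex set set" where "T_tiles = tri ` range up"

definition E_tiles :: "complex \<Rightarrow> complex set set" where "E_tiles x = tri ` down ` {v. e3 v = x}"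

text \<open>\<open>lat\<close> and \<open>chi\<close> transform under \<open>act s\<close> with the
  same linear part \<open>e3 s\<close>, and so does every combination with weights
  \<open>beta\<close> and \<open>Q\<close>. This is why the rotations survive the
  deformation.\<close>

lemma motion_V: "motion s (V v) = V (act s v)"
  by (simp add: motion_def V_def lat_act chi_act algebra_simps)

lemma motion_zero [simp]: "motion 0 = id"
  by (rule ext) (simp add: motion_def V_def)

lemma motion_motion: "motion s (motion t z) = motion (act s t) z"
  by (simp add: motion_def e3_act flip: motion_V) (simp add: motion_def algebra_simps)

lemma motion_inverse: obtains t where "\<And>z. motion t (motion s z) = z" "\<And>z. motion s (motion t z) = z"
  using act_inverse[of s] that by (metis motion_motion motion_zero id_apply)

lemma isometry_motion: "isometry (motion s)"
  unfolding isometry_def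
proof (intro allI)
  fix x y
  have "motion s x - motion s y = e3 s * (x - y)" by (simp add: motion_def algebra_simps)
  then show "dist (motion s x) (motion s y) = dist x y" by (simp add: dist_norm norm_mult)
qed

lemma bij_motion: "bij (motion s)"
  using motion_inverse[of s] by (metis bijI')

lemma motion_tri: "motion s ` tri S = tri (act s ` S)"
proof -
  have "motion s = (\<lambda>z. e3 s * z + V s)" by (simp add: motion_def fun_eq_iff)
  then have "motion s ` tri S = convex hull (motion s ` V ` S)"
    by (simp only: tri_def affine_image_convex_hull)
  then show ?thesis by (simp add: tri_def image_image motion_V)
qed

lemma motion_T_tiles: "(`) (motion s) ` T_tiles = T_tiles"
proof -
  have *: "(`) (motion s) ` T_tiles \<subseteq> T_tiles" for s
  proof clarify
    fix K assume "K \<in> T_tiles"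
    then obtain v where "K = tri (up v)" by (auto simp: T_tiles_def)
    then show "motion s ` K \<in> T_tiles" using act_up[of s v] by (metis motion_tri T_tiles_def imageI rangeI)
  qed
  obtain t where "\<And>z. motion t (motion s z) = z" and t: "\<And>z. motion s (motion t z) = z" using motion_inverse[of s] by blast
  have "K = motion s ` motion t ` K" for K by (simp add: image_image t)
  then have "T_tiles \<subseteq> (`) (motion s) ` T_tiles" using *[of t] by blast
  with * show ?thesis by blast
qed

lemma motion_E_tiles: "(`) (motion s) ` E_tiles x = E_tiles x"
proof -
  have *: "(`) (motion s) ` E_tiles x \<subseteq> E_tiles x" for s
  proof clarify
    fix K assume "K \<in> E_tiles x"
    then obtain v where v: "K = tri (down v)" "e3 v = x" by (auto simp: E_tiles_def)
    obtain w where w: "act s ` down v = down w" "e3 w = e3 v" using act_down by blast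
    have "motion s ` K = tri (down w)" by (simp add: v motion_tri w)
    then show "motion s ` K \<in> E_tiles x" using w v by (auto simp: E_tiles_def)
  qed
  obtain t where "\<And>z. motion t (motion s z) = z" and t: "\<And>z. motion s (motion t z) = z" using motion_inverse[of s] by blast
  have "K = motion s ` motion t ` K" for K by (simp add: image_image t)
  then have "E_tiles x \<subseteq> (`) (motion s) ` E_tiles x" using *[of t] by blast
  with * show ?thesis by blast
qed

lemma tri_cells_eq: "tri ` cells = T_tiles \<union> E_tiles 1 \<union> E_tiles (kap\<^sup>2) \<union> E_tiles kap"
proof -
  have "{v. e3 v = 1} \<union> {v. e3 v = kap\<^sup>2} \<union> {v. e3 v = kap} = UNIV" using e3_cases by blast
  then have "range down = down ` {v. e3 v = 1} \<union> down ` {v. e3 v = kap\<^sup>2} \<union> down ` {v. e3 v = kap}"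
    by (simp flip: image_Un)
  then show ?thesis by (simp only: cells_def T_tiles_def E_tiles_def image_Un Un_assoc)
qed

lemma not_collinear_V:
  assumes "\<not> affine_dependent (V ` {p, q, r})" "p \<noteq> q" "p \<noteq> r" "q \<noteq> r"
  shows "\<not> collinear {V p, V q, V r}"
  using assms by (simp add: collinear_3_eq_affine_dependent inj_eq[OF inj_V])

lemma motion_mem_symmetries: "motion s \<in> symmetries {T_tiles, E_tiles 1, E_tiles (kap\<^sup>2), E_tiles kap}"
  by (simp add: symmetries_def isometry_motion motion_T_tiles motion_E_tiles)

text \<open>Composition with a motion reduces to a symmetry preserving \<open>tri (up 0)\<close>. At
  each of its vertices some downward tile touches this triangle in that vertex only. The kind of the
  touching tile is preserved and determines the vertex, so all three vertices are fixed.\<close>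

lemma symmetries_subset: "symmetries {T_tiles, E_tiles 1, E_tiles (kap\<^sup>2), E_tiles kap} \<subseteq> range motion"
proof
  fix f assume f: "f \<in> symmetries {T_tiles, E_tiles 1, E_tiles (kap\<^sup>2), E_tiles kap}"
  then have iso: "isometry f" and fT: "(`) f ` T_tiles = T_tiles" by (simp_all add: symmetries_def)
  have fE: "(`) f ` E_tiles x = E_tiles x" if "x \<in> {1, kap, kap\<^sup>2}" for x
    using f that by (auto simp: symmetries_def)
  have e3_mem: "e3 v \<in> {1, kap, kap\<^sup>2}" for v using e3_cases by blast
  have "tri (up 0) \<in> T_tiles" by (simp add: T_tiles_def)
  then have "f ` tri (up 0) \<in> T_tiles" using fT by blast
  then obtain v where v: "f ` tri (up 0) = tri (up v)" by (auto simp: T_tiles_def)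
  obtain s where s: "act s ` up 0 = up v" using up_eq_act by blast
  obtain t where t: "\<And>z. motion t (motion s z) = z" "\<And>z. motion s (motion t z) = z" using motion_inverse[of s] by blast
  define h where "h z = motion t (f z)" for z
  have h_image: "h ` X = motion t ` f ` X" for X by (simp add: h_def image_image)
  have isoh: "isometry h"
    using iso isometry_motion[of t] by (simp add: isometry_def h_def)
  then have injh: "inj h" unfolding isometry_def by (metis dist_eq_0_iff injI)
  have hT: "h ` tri (up 0) = tri (up 0)"
  proof -
    have "h ` tri (up 0) = motion t ` motion s ` tri (up 0)" by (simp only: h_image v motion_tri s)
    then show ?thesis by (simp add: image_image t)
  qed
  have hE: "h ` K \<in> E_tiles x" if "K \<in> E_tiles x" "x \<in> {1, kap, kap\<^sup>2}" for K x
  proof -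
    have "f ` K \<in> E_tiles x" using fE[OF that(2)] that(1) by blast
    then show ?thesis unfolding h_image using motion_E_tiles[of t x] by blast
  qed
  have fix_V: "h (V a) = V a" if a: "a \<in> up 0" for a
  proof -
    obtain w where w: "down w \<inter> up 0 = {a}" using ex_down_Int_up_0[OF a] by blast
    have cells: "down w \<in> cells" "up 0 \<in> cells" for w by (auto simp: cells_def)
    have one: "tri (down w) \<inter> tri (up 0) = {V a}"
      using tri_Int_cells[OF cells] w by (simp add: tri_def)
    have "h ` tri (down w) \<in> E_tiles (e3 w)"
      using hE[of "tri (down w)" "e3 w"] e3_mem[of w] by (auto simp: E_tiles_def)
    then obtain w' where w': "h ` tri (down w) = tri (down w')" "e3 w' = e3 w"
      by (auto simp: E_tiles_def)
    have "{h (V a)} = h ` (tri (down w) \<inter> tri (up 0))" using one by simp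
    also have "\<dots> = tri (down w') \<inter> tri (up 0)" by (simp add: image_Int[OF injh] hT w')
    also have "\<dots> = tri (down w' \<inter> up 0)" using tri_Int_cells[OF cells] .
    finally have sing: "tri (down w' \<inter> up 0) = {h (V a)}" ..
    \<comment> \<open>The image tile meets the triangle in one point, so by injectivity of
      \<open>V\<close> the two cells share exactly one vertex and the colour argument applies to it
      too.\<close>
    have "b = c" if "b \<in> down w' \<inter> up 0" "c \<in> down w' \<inter> up 0" for b c
    proof -
      have "V b \<in> tri (down w' \<inter> up 0)" "V c \<in> tri (down w' \<inter> up 0)"
        using that by (auto simp: tri_def intro: hull_inc)
      then show ?thesis using sing injD[OF inj_V] by auto
    qed
    moreover have "down w' \<inter> up 0 \<noteq> {}" using sing by (auto simp: tri_def)
    ultimately obtain b where b: "down w' \<inter> up 0 = {b}" by blast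
    have "e3 b = e3 a" using down_Int_up_0[OF b] down_Int_up_0[OF w] w'(2) by simp
    moreover have "b \<in> up 0" using b by blast
    ultimately have "b = a" using a e3_inj_up_0 by blast
    then show ?thesis using sing b by (simp add: tri_def)
  qed
  have "h z = z" for z
  proof (rule isometry_fixing_triangle[OF isoh])
    show "h (V 0) = V 0" "h (V (1,0)) = V (1,0)" "h (V (0,1)) = V (0,1)"
      by (auto intro!: fix_V simp: up_def)
    have "up 0 \<in> cells" "up 0 = {0, (1,0), (0,1)}" by (auto simp: cells_def up_def)
    then have "\<not> affine_dependent (V ` {0, (1,0), (0,1)})" using affine_independent_V by metis
    then show "\<not> collinear {V 0, V (1,0), V (0,1)}"
      by (rule not_collinear_V) (simp_all add: prod_eq_iff)
  qed
  then have "f z = motion s z" for z using t by (metis h_def)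
  then have "f = motion s" by blast
  then show "f \<in> range motion" by blast
qed

lemma symmetries_eq: "symmetries {T_tiles, E_tiles 1, E_tiles (kap\<^sup>2), E_tiles kap} = range motion"
  using symmetries_subset motion_mem_symmetries by blast

subsection \<open>Generation by three rotations\<close>

text \<open>The fixed point of \<open>motion s\<close> in the case
  \<open>e3 s = kap\<^sup>2\<close>.\<close>

definition center :: "int \<times> int \<Rightarrow> complex" where
  "center s = V s / (1 - kap\<^sup>2)"

lemma rotation_center:
  assumes "e3 s = kap\<^sup>2"
  shows "rotation (center s) (2 * pi / 3) = motion s"
proof
  fix z
  have "rotation (center s) (2 * pi / 3) z = kap\<^sup>2 * z + (1 - kap\<^sup>2) * center s"
    unfolding rotation_def cis_2pi_3 by (simp add: algebra_simps)
  then show "rotation (center s) (2 * pi / 3) z = motion s z"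
    using kap_sq_ne_1 by (simp add: center_def motion_def assms)
qed

text \<open>Equal colours cancel the \<open>Q\<close> terms, so up to scale these distances are
  those of the regular tiling. For the centres of neighbouring equilateral tiles this is Napoleon's
  theorem.\<close>

lemma dist_center:
  assumes "e3 s = e3 t"
  shows "dist (center s) (center t) = norm beta * norm (lat (s - t)) / norm (1 - kap\<^sup>2)"
proof -
  have "chi s = chi t" using assms by (simp add: chi_def)
  then have "center s - center t = beta * lat (s - t) / (1 - kap\<^sup>2)"
    by (simp add: center_def V_def lat_diff algebra_simps flip: diff_divide_distrib)
  then show ?thesis by (simp add: dist_norm norm_mult norm_divide)
qed

lemma motion_compose: "motion s \<circ> motion t = motion (act s t)"
  by (simp add: fun_eq_iff motion_motion)

lemma motion_in_Bij: "motion s \<in> Bij UNIV"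
  using bij_motion by (simp add: Bij_def)

lemma BijGroup_mult: "f \<in> Bij UNIV \<Longrightarrow> g \<in> Bij UNIV \<Longrightarrow> f \<otimes>\<^bsub>BijGroup UNIV\<^esub> g = f \<circ> g"
  by (simp add: BijGroup_def compose_def fun_eq_iff)

lemma BijGroup_one: "\<one>\<^bsub>BijGroup UNIV\<^esub> = id"
  by (simp add: BijGroup_def fun_eq_iff)

lemma subgroup_range_motion: "subgroup (range motion) (BijGroup UNIV)"
proof -
  interpret group "BijGroup (UNIV :: complex set)" by (rule group_BijGroup)
  show ?thesis
  proof (rule subgroupI)
    show "range motion \<subseteq> carrier (BijGroup UNIV)" using motion_in_Bij by (auto simp: BijGroup_def)
    fix f assume "f \<in> range motion"
    then obtain s where s: "f = motion s" by blast
    obtain t where t: "\<And>z. motion t (motion s z) = z" and "\<And>z. motion s (motion t z) = z" using motion_inverse[of s] by blast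
    have "motion t \<otimes>\<^bsub>BijGroup UNIV\<^esub> f = \<one>\<^bsub>BijGroup UNIV\<^esub>"
      using t by (simp add: s BijGroup_mult motion_in_Bij BijGroup_one fun_eq_iff)
    then have "inv\<^bsub>BijGroup UNIV\<^esub> f = motion t"
      by (rule inv_equality) (simp_all add: s motion_in_Bij, simp_all add: BijGroup_def motion_in_Bij)
    then show "inv\<^bsub>BijGroup UNIV\<^esub> f \<in> range motion" by simp
  next
    fix f g assume "f \<in> range motion" "g \<in> range motion"
    then show "f \<otimes>\<^bsub>BijGroup UNIV\<^esub> g \<in> range motion"
      by (auto simp: BijGroup_mult motion_in_Bij motion_compose)
  qed simp
qed

text \<open>Quotients of the three generating rotations are the translations by \<open>(1,1)\<close> and \<open>(2,-1)\<close>,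
  which span the lattice of all translations in the group.\<close>

lemma S333_eq: "S333 (center (0,1)) (center (-1,0)) (center (1,-1)) = range motion"
proof -
  let ?B = "BijGroup (UNIV :: complex set)"
  interpret group ?B by (rule group_BijGroup)
  have e: "e3 (0,1) = kap\<^sup>2" "e3 (-1,0) = kap\<^sup>2" "e3 (1,-1) = kap\<^sup>2"
    by (simp_all add: e3_eq_mod)
  define R where "R = {motion (0,1), motion (-1,0), motion (1,-1)}"
  have S: "S333 (center (0,1)) (center (-1,0)) (center (1,-1)) = generate ?B R"
    unfolding S333_def R_def by (simp only: rotation_center[OF e(1)] rotation_center[OF e(2)] rotation_center[OF e(3)])
  have RF: "R \<subseteq> range motion" by (auto simp: R_def)
  have RB: "R \<subseteq> carrier ?B" using RF motion_in_Bij by (auto simp: BijGroup_def)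
  have sub: "subgroup (generate ?B R) ?B" by (rule generate_is_subgroup[OF RB])
  have mult: "motion (act s t) \<in> generate ?B R" if "motion s \<in> generate ?B R" "motion t \<in> generate ?B R" for s t
    using subgroup.m_closed[OF sub that] by (simp add: BijGroup_mult motion_in_Bij motion_compose)
  have inv: "motion t \<in> generate ?B R" if "motion s \<in> generate ?B R" "act t s = 0" for s t
  proof -
    have "motion t \<otimes>\<^bsub>?B\<^esub> motion s = \<one>\<^bsub>?B\<^esub>"
      by (simp add: BijGroup_mult motion_in_Bij BijGroup_one motion_compose that)
    then have "inv\<^bsub>?B\<^esub> motion s = motion t"
      by (rule inv_equality) (simp_all add: BijGroup_def motion_in_Bij)
    then show ?thesis using subgroup.m_inv_closed[OF sub that(1)] by simp
  qed
  have gen: "motion s \<in> generate ?B R" if "motion s \<in> R" for s using that by (rule generate.incl)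
  have act1: "act t s = t + s" if "e3 t = 1" for s t
    using that by (cases rule: act_cases[of t]) (auto simp: kap_def complex_eq_iff power2_eq_square)
  have act2: "act t s = t + mulk s" if "e3 t = kap" for s t
    using that by (cases rule: act_cases[of t]) (auto simp: kap_def complex_eq_iff power2_eq_square)
  have act3: "act t s = t + mulk (mulk s)" if "e3 t = kap\<^sup>2" for s t
    using that by (cases rule: act_cases[of t]) (auto simp: kap_def complex_eq_iff power2_eq_square)
  have k: "e3 (0,-1) = kap" by (simp add: e3_def)
  \<comment> \<open>The inverse of one generator, turning clockwise; following it by another
    generator gives a translation.\<close>
  have g1: "motion (0,-1) \<in> generate ?B R"
  proof (rule inv[of "(-1,0)"])
    show "motion (-1,0) \<in> generate ?B R" by (rule gen) (simp add: R_def)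
    show "act (0,-1) (-1,0) = 0" by (subst act2[OF k]) (simp add: mulk_def prod_eq_iff)
  qed
  have "act (0,1) (0,-1) = (1,1)" by (subst act3[OF e(1)]) (simp add: mulk_def)
  then have t1: "motion (1,1) \<in> generate ?B R"
    using mult[of "(0,1)", OF gen g1] by (simp add: R_def)
  have "act (1,-1) (0,-1) = (2,-1)" by (subst act3[OF e(3)]) (simp add: mulk_def)
  then have t2: "motion (2,-1) \<in> generate ?B R"
    using mult[of "(1,-1)", OF gen g1] by (simp add: R_def)
  have plus: "motion (s + t) \<in> generate ?B R" if "motion s \<in> generate ?B R" "motion t \<in> generate ?B R" "e3 s = 1" for s t
    using mult[OF that(1,2)] act1[OF that(3)] by simp
  have neg: "motion (- s) \<in> generate ?B R \<and> e3 (- s) = 1" if "motion s \<in> generate ?B R" "e3 s = 1" for s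
  proof -
    have "e3 (- s) * e3 s = 1" by (simp flip: e3_add)
    then have "e3 (- s) = 1" using that by simp
    then show ?thesis using inv[OF that(1), of "- s"] act1 by simp
  qed
  have nat_mult: "motion (of_nat k * a, of_nat k * b) \<in> generate ?B R \<and> e3 (of_nat k * a, of_nat k * b) = 1"
    if "motion (a, b) \<in> generate ?B R" "e3 (a, b) = 1" for k a b
  proof (induction k)
    case 0
    have "motion 0 \<in> generate ?B R" using subgroup.one_closed[OF sub] by (simp add: BijGroup_one)
    then show ?case using e3_zero by (simp add: zero_prod_def)
  next
    case (Suc k)
    have "(of_nat (Suc k) * a, of_nat (Suc k) * b) = (a, b) + (of_nat k * a, of_nat k * b)"
      by (simp add: algebra_simps)
    then show ?case using plus[OF that(1) _ that(2)] Suc that(2) by (simp only: e3_add mult_1 simp_thms)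
  qed
  have int_mult: "motion (k * a, k * b) \<in> generate ?B R \<and> e3 (k * a, k * b) = 1"
    if "motion (a, b) \<in> generate ?B R" "e3 (a, b) = 1" for k a b
  proof (cases "k \<ge> 0")
    case True
    then show ?thesis using nat_mult[OF that, of "nat k"] by simp
  next
    case False
    then show ?thesis using nat_mult[OF that, of "nat (- k)"] neg[of "(- k * a, - k * b)"] by simp
  qed
  have e12: "e3 (1,1) = 1" "e3 (2,-1) = 1" by simp (simp add: e3_eq_mod)
  have trans: "motion s \<in> generate ?B R" if "e3 s = 1" for s
  proof -
    obtain m n where s: "s = (m, n)" by (cases s)
    have "(m - n) mod 3 = 0" using that e3_eq_iff[of s 0] by (simp add: s)
    then obtain y where "m - n = 3 * y" by (meson mod_0_imp_dvd dvdE)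
    \<comment> \<open>Since \<open>m = n + 3 * y\<close>, these are the coordinates of
      \<open>s\<close> in the basis \<open>(1,1)\<close>, \<open>(2,-1)\<close> of the sublattice of
      colour 1.\<close>
    then have "s = ((n + y) * 1, (n + y) * 1) + (y * 2, y * -1)" by (simp add: s)
    then show ?thesis
      using plus[of "((n + y) * 1, (n + y) * 1)" "(y * 2, y * -1)"]
        int_mult[OF t1 e12(1), of "n + y"] int_mult[OF t2 e12(2), of y] by simp
  qed
  have "motion s \<in> generate ?B R" for s
  proof -
    \<comment> \<open>Motions of the same colour differ by a translation, so one representative per
      colour suffices.\<close>
    have *: "motion s \<in> generate ?B R" if "e3 r = e3 s" "motion r \<in> generate ?B R" for r
    proof -
      have "e3 (s - r) * e3 r = e3 s" by (simp flip: e3_add)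
      then have "e3 (s - r) = 1" using that(1) by simp
      then show ?thesis using plus[OF trans that(2), of "s - r"] by simp
    qed
    have "motion (0,1) \<in> generate ?B R" by (rule gen) (simp add: R_def)
    then show ?thesis using e3_cases[of s] trans[of s] *[of "(0,1)"] *[of "(0,-1)"] g1 k e(1) by metis
  qed
  then show ?thesis
    unfolding S using generate_subgroup_incl[OF RF subgroup_range_motion] by blast
qed

end

section \<open>The hexagonal star of a vertex\<close>

lemma cXY_simps [simp]: "cX 0 = 0" "cY 0 = 0" "cX 1 = 1" "cY 1 = 0" "cX om = 0" "cY om = 1"
  by (simp_all add: cX_def cY_def)

lemma e3_step: "e3 (v + (1,0)) = e3 v * kap" "e3 (v + (0,1)) = e3 v * kap\<^sup>2" "e3 (v + (1,1)) = e3 v"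
proof -
  have "- cnj om = kap\<^sup>2" by (simp add: complex_eq_iff kap_def power2_eq_square)
  then show "e3 (v + (1,0)) = e3 v * kap" "e3 (v + (0,1)) = e3 v * kap\<^sup>2" "e3 (v + (1,1)) = e3 v"
    by (simp_all only: e3_add e3_10 e3_01 e3_11 kap_def mult_1_right)
qed

text \<open>The vertices of a cell carry the colours \<open>x\<close>, \<open>x * kap\<close>,
  \<open>x * kap\<^sup>2\<close> in some order. Different vertices of one colour therefore share no
  cell, and their stars do not overlap.\<close>

lemma e3_inj_cell:
  assumes "S \<in> cells" "s \<in> S" "t \<in> S" "e3 s = e3 t"
  shows "s = t"
proof -
  have ne: "e3 v * kap \<noteq> e3 v" "e3 v * kap\<^sup>2 \<noteq> e3 v" "e3 v * kap \<noteq> e3 v * kap\<^sup>2" for v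
  proof -
    have "kap \<noteq> 1" "kap\<^sup>2 \<noteq> 1" "kap \<noteq> kap\<^sup>2"
      by (simp_all add: kap_def complex_eq_iff power2_eq_square)
    then show "e3 v * kap \<noteq> e3 v" "e3 v * kap\<^sup>2 \<noteq> e3 v" "e3 v * kap \<noteq> e3 v * kap\<^sup>2" by simp_all
  qed
  note ne = ne ne[symmetric]
  from assms(1) consider w where "S = up w" | w where "S = down w" unfolding cells_def by blast
  then show ?thesis
  proof cases
    case 1
    then have "s = w \<or> s = w + (1,0) \<or> s = w + (0,1)" "t = w \<or> t = w + (1,0) \<or> t = w + (0,1)"
      using assms by (simp_all add: up_def)
    then show ?thesis using assms(4) by (elim disjE) (simp_all only: e3_step ne)
  next
    case 2
    then have "s = w + (1,0) \<or> s = w + (0,1) \<or> s = w + (1,1)" "t = w + (1,0) \<or> t = w + (0,1) \<or> t = w + (1,1)"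
      using assms by (simp_all add: down_def)
    then show ?thesis using assms(4) by (elim disjE) (simp_all only: e3_step ne)
  qed
qed

text \<open>Puts every cell into the star of some vertex of colour 1: the covering half of the
  hexagonal tiling.\<close>

lemma ex_e3_eq_1:
  assumes "S \<in> cells"
  shows "\<exists>s\<in>S. e3 s = 1"
proof -
  from assms consider v where "S = up v" | v where "S = down v" unfolding cells_def by blast
  then obtain v where v: "v + (1,0) \<in> S" "v + (0,1) \<in> S" "v \<in> S \<or> v + (1,1) \<in> S"
    by cases (auto simp: up_def down_def)
  consider "e3 v = 1" | "e3 v = kap" | "e3 v = kap\<^sup>2" using e3_cases by blast
  then show ?thesis
  proof cases
    case 1
    then show ?thesis using v(3) e3_step(3)[of v] by auto
  next
    case 2
    then show ?thesis using v(2) e3_step(2)[of v] by (auto intro: bexI[of _ "v + (0,1)"])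
  next
    case 3
    then show ?thesis using v(1) e3_step(1)[of v] by (auto intro: bexI[of _ "v + (1,0)"])
  qed
qed

lemma hexnorm_scaleR: "hexnorm (r *\<^sub>R z) = \<bar>r\<bar> * hexnorm z"
  unfolding hexnorm_def cX_scaleR cY_scaleR distrib_left[symmetric] abs_mult
  by (simp add: max_mult_distrib_left)

lemma hexnorm_triangle: "hexnorm (z + w) \<le> hexnorm z + hexnorm w"
proof -
  have b: "\<bar>cX x\<bar> \<le> hexnorm x" "\<bar>cY x\<bar> \<le> hexnorm x" "\<bar>cX x + cY x\<bar> \<le> hexnorm x" for x
    by (simp_all add: hexnorm_def)
  have "\<bar>cX (z + w)\<bar> \<le> hexnorm z + hexnorm w" using b(1)[of z] b(1)[of w] by simp
  moreover have "\<bar>cY (z + w)\<bar> \<le> hexnorm z + hexnorm w" using b(2)[of z] b(2)[of w] by simp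
  moreover have "\<bar>cX (z + w) + cY (z + w)\<bar> \<le> hexnorm z + hexnorm w"
    using b(3)[of z] b(3)[of w] by simp
  ultimately show ?thesis unfolding hexnorm_def[of "z + w"] by simp
qed

lemma continuous_hexnorm [continuous_intros]:
  "continuous_on S f \<Longrightarrow> continuous_on S (\<lambda>x. hexnorm (f x))"
  unfolding hexnorm_def by (intro continuous_intros)

lemma convex_hexnorm_le: "convex {z. hexnorm (z - c) \<le> r}"
proof (rule convexI)
  fix x y and a b :: real
  assume "x \<in> {z. hexnorm (z - c) \<le> r}" "y \<in> {z. hexnorm (z - c) \<le> r}"
    and ab: "0 \<le> a" "0 \<le> b" "a + b = 1"
  then have xy: "hexnorm (x - c) \<le> r" "hexnorm (y - c) \<le> r" by auto
  have "a *\<^sub>R x + b *\<^sub>R y - c = a *\<^sub>R (x - c) + b *\<^sub>R (y - c)"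
    using ab scaleR_add_left[of a b c] by (simp add: algebra_simps)
  then have "hexnorm (a *\<^sub>R x + b *\<^sub>R y - c) \<le> a * hexnorm (x - c) + b * hexnorm (y - c)"
    using hexnorm_triangle[of "a *\<^sub>R (x - c)" "b *\<^sub>R (y - c)"] ab by (simp add: hexnorm_scaleR)
  also have "\<dots> \<le> a * r + b * r" using xy ab by (intro add_mono mult_left_mono)
  also have "\<dots> = r" using ab by (simp flip: distrib_right)
  finally show "a *\<^sub>R x + b *\<^sub>R y \<in> {z. hexnorm (z - c) \<le> r}" by simp
qed

lemma cell_difference:
  assumes "S \<in> cells" "s \<in> S" "v \<in> S"
  shows "hexnorm (lat s - lat v) \<le> 1"
proof -
  from assms(1) consider w where "S = up w" | w where "S = down w" unfolding cells_def by blast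
  then show ?thesis
  proof cases
    case 1
    then have "s \<in> {w, w + (1,0), w + (0,1)}" "v \<in> {w, w + (1,0), w + (0,1)}"
      using assms by (simp_all add: up_def)
    then show ?thesis by (elim insertE emptyE; simp add: hexnorm_def)
  next
    case 2
    then have "s \<in> {w + (1,0), w + (0,1), w + (1,1)}" "v \<in> {w + (1,0), w + (0,1), w + (1,1)}"
      using assms by (simp_all add: down_def)
    then show ?thesis by (elim insertE emptyE; simp add: hexnorm_def)
  qed
qed

lemma rtri_star: "(\<Union>S\<in>{S \<in> cells. v \<in> S}. rtri S) = {z. hexnorm (z - lat v) \<le> 1}"
proof
  show "(\<Union>S\<in>{S \<in> cells. v \<in> S}. rtri S) \<subseteq> {z. hexnorm (z - lat v) \<le> 1}"
  proof clarify
    fix S z assume S: "S \<in> cells" "v \<in> S" "z \<in> rtri S"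
    have "rtri S \<subseteq> {z. hexnorm (z - lat v) \<le> 1}"
      unfolding rtri_def using S
      by (intro hull_minimal convex_hexnorm_le image_subsetI CollectI cell_difference)
    with S show "hexnorm (z - lat v) \<le> 1" by blast
  qed
  show "{z. hexnorm (z - lat v) \<le> 1} \<subseteq> (\<Union>S\<in>{S \<in> cells. v \<in> S}. rtri S)"
  proof
    fix z assume "z \<in> {z. hexnorm (z - lat v) \<le> 1}"
    then have z: "hexnorm (z - lat v) \<le> 1" by simp
    text \<open>Shrinking towards \<open>lat v\<close> moves boundary points into the open star of \<open>v\<close>.\<close>
    define y where "y = lat v + (1/2) *\<^sub>R (z - lat v)"
    have "hexnorm (y - lat v) \<le> 1/2" using z by (simp add: y_def hexnorm_scaleR)
    then have hy: "hat y v \<ge> 1/2" by (simp add: hat_def)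
    obtain S where S: "S \<in> cells" "y \<in> rtri S" using ex_cell by blast
    then have vS: "v \<in> S" using hat_cell(1)[OF S, of v] hy by force
    \<comment> \<open>Barycentric coordinates of \<open>z\<close>, from undoing
      \<open>y = (z + lat v) / 2\<close>. The one at \<open>v\<close> is nonnegative because
      \<open>hat y v\<close> is at least 1/2.\<close>
    let ?c = "\<lambda>s. 2 * hat y s - (if s = v then 1 else 0)"
    have fin: "finite S" using S finite_cell by blast
    have "sum ?c S = 1"
      using hat_cell(2)[OF S] vS fin by (simp add: sum_subtractf flip: sum_distrib_left)
    moreover have "\<forall>s\<in>S. 0 \<le> ?c s" using hy by auto
    moreover have "z = (\<Sum>s\<in>S. ?c s *\<^sub>R lat s)"
    proof -
      have "(\<Sum>s\<in>S. ?c s *\<^sub>R lat s) = 2 *\<^sub>R (\<Sum>s\<in>S. hat y s *\<^sub>R lat s) - (\<Sum>s\<in>S. if s = v then lat s else 0)"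
        unfolding scaleR_sum_right sum_subtractf[symmetric] by (rule sum.cong) (auto simp: algebra_simps)
      also have "(\<Sum>s\<in>S. hat y s *\<^sub>R lat s) = y" using hat_cell(3)[OF S] by (rule sym)
      also have "2 *\<^sub>R y - (\<Sum>s\<in>S. if s = v then lat s else 0) = z"
        using vS fin by (simp add: y_def algebra_simps scaleR_2)
      finally show ?thesis by (rule sym)
    qed
    ultimately have "z \<in> rtri S"
      unfolding rtri_def convex_hull_image_explicit[OF fin]
      by (intro CollectI exI[of _ ?c] conjI)
    then show "z \<in> (\<Union>S\<in>{S \<in> cells. v \<in> S}. rtri S)" using S vS by blast
  qed
qed

lemma interior_hexnorm_le: "interior {z. hexnorm (z - c) \<le> 1} = {z. hexnorm (z - c) < 1}"
proof
  have "open {z. hexnorm (z - c) < 1}" by (intro open_Collect_less continuous_intros)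
  then show "{z. hexnorm (z - c) < 1} \<subseteq> interior {z. hexnorm (z - c) \<le> 1}"
    by (intro interior_maximal) auto
  show "interior {z. hexnorm (z - c) \<le> 1} \<subseteq> {z. hexnorm (z - c) < 1}"
  proof
    fix z assume "z \<in> interior {z. hexnorm (z - c) \<le> 1}"
    then obtain e where e: "e > 0" "ball z e \<subseteq> {z. hexnorm (z - c) \<le> 1}"
      by (auto simp: mem_interior)
    \<comment> \<open>Scaling away from \<open>c\<close> by \<open>1 + r\<close> stays in the ball
      but would push a point of norm 1 out of the hexagon. The added 1 keeps the denominator
      positive at \<open>z = c\<close>.\<close>
    define r where "r = e / (2 * (norm (z - c) + 1))"
    have r: "r > 0" using e by (simp add: r_def add_nonneg_pos)
    have "norm (r *\<^sub>R (z - c)) < e"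
    proof -
      have "norm (z - c) < 2 * (norm (z - c) + 1)" by (smt (verit) norm_ge_zero)
      then have "e * norm (z - c) < e * (2 * (norm (z - c) + 1))" using e by simp
      then show ?thesis using e by (simp add: r_def pos_divide_less_eq add_nonneg_pos)
    qed
    then have "z + r *\<^sub>R (z - c) \<in> ball z e" by (simp add: dist_norm)
    then have "hexnorm ((1 + r) *\<^sub>R (z - c)) \<le> 1" using e by (auto simp: algebra_simps)
    then have *: "(1 + r) * hexnorm (z - c) \<le> 1" using r unfolding hexnorm_scaleR by simp
    have "hexnorm (z - c) < 1"
    proof (rule ccontr)
      assume "\<not> hexnorm (z - c) < 1"
      then have "(1 + r) * 1 \<le> (1 + r) * hexnorm (z - c)" using r by (intro mult_left_mono) auto
      from order_trans[OF this *] show False using r by simp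
    qed
    then show "z \<in> {z. hexnorm (z - c) < 1}" by simp
  qed
qed

lemma closed_segment_XY:
  "z \<in> closed_segment a b \<longleftrightarrow>
    (\<exists>t. 0 \<le> t \<and> t \<le> 1 \<and> cX z = (1 - t) * cX a + t * cX b \<and> cY z = (1 - t) * cY a + t * cY b)"
proof -
  have "z = (1 - t) *\<^sub>R a + t *\<^sub>R b \<longleftrightarrow>
      cX z = (1 - t) * cX a + t * cX b \<and> cY z = (1 - t) * cY a + t * cY b" for t
    using complex_eqI_XY[of z "(1 - t) *\<^sub>R a + t *\<^sub>R b"] by auto
  then show ?thesis by (auto simp: closed_segment_def)
qed

lemma hexnorm_eq_1_segments:
  "{z. hexnorm z = 1} =
     closed_segment (lat (1,0)) (lat (0,1)) \<union> closed_segment (lat (0,1)) (lat (-1,1)) \<union>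
     closed_segment (lat (-1,1)) (lat (-1,0)) \<union> closed_segment (lat (-1,0)) (lat (0,-1)) \<union>
     closed_segment (lat (0,-1)) (lat (1,-1)) \<union> closed_segment (lat (1,-1)) (lat (1,0))"
    (is "_ = ?R")
proof
  show "{z. hexnorm z = 1} \<subseteq> ?R"
  proof
    fix z assume "z \<in> {z. hexnorm z = 1}"
    then have z: "max \<bar>cX z\<bar> (max \<bar>cY z\<bar> \<bar>cX z + cY z\<bar>) = 1" by (simp add: hexnorm_def)
    define x y where "x = cX z" "y = cY z"
    have "x + y = 1 \<and> 0 \<le> x \<and> 0 \<le> y \<or> y = 1 \<and> -1 \<le> x \<and> x \<le> 0 \<or> x = -1 \<and> 0 \<le> y \<and> y \<le> 1 \<or>
      x + y = -1 \<and> x \<le> 0 \<and> y \<le> 0 \<or> y = -1 \<and> 0 \<le> x \<and> x \<le> 1 \<or> x = 1 \<and> -1 \<le> y \<and> y \<le> 0"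
      using z unfolding x_y_def[symmetric] by (simp add: max_def abs_if split: if_splits)
    then consider "x + y = 1" "0 \<le> x" "0 \<le> y" | "y = 1" "-1 \<le> x" "x \<le> 0" | "x = -1" "0 \<le> y" "y \<le> 1" |
      "x + y = -1" "x \<le> 0" "y \<le> 0" | "y = -1" "0 \<le> x" "x \<le> 1" | "x = 1" "-1 \<le> y" "y \<le> 0" by blast
    then show "z \<in> ?R"
    proof cases
      case 1
      then have "z \<in> closed_segment (lat (1,0)) (lat (0,1))"
        unfolding closed_segment_XY x_y_def by (intro exI[of _ "cY z"]) auto
      then show ?thesis by blast
    next
      case 2
      then have "z \<in> closed_segment (lat (0,1)) (lat (-1,1))"
        unfolding closed_segment_XY x_y_def by (intro exI[of _ "- cX z"]) auto
      then show ?thesis by blast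
    next
      case 3
      then have "z \<in> closed_segment (lat (-1,1)) (lat (-1,0))"
        unfolding closed_segment_XY x_y_def by (intro exI[of _ "1 - cY z"]) auto
      then show ?thesis by blast
    next
      case 4
      then have "z \<in> closed_segment (lat (-1,0)) (lat (0,-1))"
        unfolding closed_segment_XY x_y_def by (intro exI[of _ "- cY z"]) auto
      then show ?thesis by blast
    next
      case 5
      then have "z \<in> closed_segment (lat (0,-1)) (lat (1,-1))"
        unfolding closed_segment_XY x_y_def by (intro exI[of _ "cX z"]) auto
      then show ?thesis by blast
    next
      case 6
      then have "z \<in> closed_segment (lat (1,-1)) (lat (1,0))"
        unfolding closed_segment_XY x_y_def by (intro exI[of _ "1 + cY z"]) auto
      then show ?thesis by blast
    qed
  qed
  show "?R \<subseteq> {z. hexnorm z = 1}"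
    unfolding Un_iff subset_iff mem_Collect_eq closed_segment_XY hexnorm_def
    by (intro allI impI; elim disjE exE conjE; simp)
qed

lemma bounded_hexnorm_le: "bounded {z. hexnorm z \<le> 1}"
proof (rule boundedI)
  fix z assume "z \<in> {z. hexnorm z \<le> 1}"
  then have "\<bar>cX z\<bar> \<le> 1" "\<bar>cY z\<bar> \<le> 1" by (simp_all add: hexnorm_def)
  moreover have "norm z \<le> \<bar>cX z\<bar> + \<bar>cY z\<bar>"
    using norm_triangle_ineq[of "of_real (cX z)" "of_real (cY z) * om"] cXY_eq[of z]
    by (simp add: norm_mult)
  ultimately show "norm z \<le> 2" by simp
qed

lemma inside_hexnorm_eq_1: "inside {z. hexnorm z = 1} = {z. hexnorm z < 1}"
proof -
  have "closed {z. hexnorm z \<le> 1}" by (intro closed_Collect_le continuous_intros)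
  then have "frontier {z. hexnorm z \<le> 1} = {z. hexnorm z = 1}"
    using interior_hexnorm_le[of 0] by (auto simp: frontier_def)
  then show ?thesis
    using inside_frontier_eq_interior[OF bounded_hexnorm_le, of] convex_hexnorm_le[of 0 1]
      interior_hexnorm_le[of 0] by simp
qed

text \<open>Sides are prepended one at a time: five of them form an arc, and the sixth closes it up,
  which takes the loop criterion instead.\<close>

lemma simple_path_closed_hexagon:
  fixes a b c d e f :: complex
  assumes "a \<noteq> b" "b \<noteq> c" "c \<noteq> d" "d \<noteq> e" "e \<noteq> f" "f \<noteq> a"
    and "closed_segment a b \<inter> closed_segment b c \<subseteq> {b}" "closed_segment b c \<inter> closed_segment c d \<subseteq> {c}"
      "closed_segment c d \<inter> closed_segment d e \<subseteq> {d}" "closed_segment d e \<inter> closed_segment e f \<subseteq> {e}"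
      "closed_segment e f \<inter> closed_segment f a \<subseteq> {f}" "closed_segment a b \<inter> closed_segment f a \<subseteq> {a}"
      "closed_segment a b \<inter> closed_segment c d = {}" "closed_segment a b \<inter> closed_segment d e = {}"
      "closed_segment a b \<inter> closed_segment e f = {}" "closed_segment b c \<inter> closed_segment d e = {}"
      "closed_segment b c \<inter> closed_segment e f = {}" "closed_segment b c \<inter> closed_segment f a = {}"
      "closed_segment c d \<inter> closed_segment e f = {}" "closed_segment c d \<inter> closed_segment f a = {}"
      "closed_segment d e \<inter> closed_segment f a = {}"
  shows "simple_path (linepath a b +++ linepath b c +++ linepath c d +++ linepath d e +++
    linepath e f +++ linepath f a)"
proof -
  have 1: "arc (linepath e f +++ linepath f a)"
    using assms by (subst arc_join_eq) auto
  have 2: "arc (linepath d e +++ linepath e f +++ linepath f a)"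
    using assms 1 by (subst arc_join_eq) (auto simp: path_image_join Int_Un_distrib)
  have 3: "arc (linepath c d +++ linepath d e +++ linepath e f +++ linepath f a)"
    using assms 2 by (subst arc_join_eq) (auto simp: path_image_join Int_Un_distrib)
  have 4: "arc (linepath b c +++ linepath c d +++ linepath d e +++ linepath e f +++ linepath f a)"
    using assms 3 by (subst arc_join_eq) (auto simp: path_image_join Int_Un_distrib)
  show ?thesis
    using assms 4 by (subst simple_path_join_loop_eq) (auto simp: path_image_join Int_Un_distrib)
qed

text \<open>The neighbours of 0 in counterclockwise order, the boundary cycle of its star.\<close>

definition hexv :: "nat \<Rightarrow> int \<times> int" where
  "hexv i = [(1,0), (0,1), (-1,1), (-1,0), (0,-1), (1,-1)] ! i"

lemma hexv_simps [simp]: "hexv 0 = (1,0)" "hexv 1 = (0,1)" "hexv (Suc 0) = (0,1)" "hexv 2 = (-1,1)" "hexv 3 = (-1,0)"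
  "hexv 4 = (0,-1)" "hexv 5 = (1,-1)"
  by (simp_all add: hexv_def)

context folded_tiling
begin

definition star :: "int \<times> int \<Rightarrow> complex set" where
  "star v = \<Union> (tri ` {S \<in> cells. v \<in> S})"

lemma star_eq: "star v = Phi ` {z. hexnorm (z - lat v) \<le> 1}"
  unfolding star_def rtri_star[symmetric] image_UN
  by (intro arg_cong[where f = Union] image_cong refl) (simp add: Phi_rtri_cell)

lemma motion_star: "motion s ` star v = star (act s v)"
  unfolding star_def act_cells_containing[symmetric] image_Union image_image motion_tri ..

lemma interior_star: "interior (star v) = Phi ` {z. hexnorm (z - lat v) < 1}"
  by (simp add: star_eq interior_Phi_image interior_hexnorm_le)

lemma interior_star_disjoint:
  assumes "e3 s = e3 t" "s \<noteq> t"
  shows "interior (star s) \<inter> interior (star t) = {}"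
proof -
  have False if "hexnorm (z - lat s) < 1" "hexnorm (z - lat t) < 1" for z
  proof -
    have h: "hat z s > 0" "hat z t > 0" using that by (simp_all add: hat_def)
    obtain S where S: "S \<in> cells" "z \<in> rtri S" using ex_cell by blast
    then have "s \<in> S" "t \<in> S" using hat_cell(1)[OF S] h by (metis less_irrefl)+
    then show False using e3_inj_cell[OF S(1)] assms by blast
  qed
  then show ?thesis
    unfolding interior_star using injD[OF inj_Phi] by blast
qed

lemma star_cover: "\<exists>s. e3 s = 1 \<and> x \<in> star s"
proof -
  obtain S where S: "S \<in> cells" "x \<in> tri S" using tri_cover by blast
  obtain s where "s \<in> S" "e3 s = 1" using ex_e3_eq_1[OF S(1)] by blast
  then show ?thesis using S unfolding star_def by blast
qed

text \<open>Motions of colour 1 are translations and put the copies around the vertices of colour 1,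
  of which each cell has exactly one.\<close>

lemma tiles_plane_star: "tiles_plane (star 0) {motion t | t. e3 t = 1}"
  unfolding tiles_plane_def
proof (intro conjI ballI impI)
  show "(\<Union>f\<in>{motion t | t. e3 t = 1}. f ` star 0) = UNIV"
  proof (intro equalityI subset_UNIV subsetI)
    fix x
    obtain s where "e3 s = 1" "x \<in> motion s ` star 0" using star_cover[of x] by (auto simp: motion_star)
    then show "x \<in> (\<Union>f\<in>{motion t | t. e3 t = 1}. f ` star 0)" by blast
  qed
  fix f g assume fg: "f \<in> {motion t | t. e3 t = 1}" "g \<in> {motion t | t. e3 t = 1}" "f \<noteq> g"
  then obtain s t where "f = motion s" "g = motion t" "e3 s = 1" "e3 t = 1" by blast
  with fg(3) show "interior (f ` star 0) \<inter> interior (g ` star 0) = {}"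
    unfolding \<open>f = motion s\<close> \<open>g = motion t\<close> motion_star act_0 by (intro interior_star_disjoint) auto
qed (auto simp: isometry_motion)

lemma segment_eq_tri: "closed_segment (V p) (V q) = tri {p, q}"
  by (simp add: tri_def segment_convex_hull)

text \<open>By \<open>tri_Int\<close> the sides intersect as their vertex sets do, whatever the
  shape of the hexagon; the enclosed region is transported from the regular hexagon by
  \<open>inside_Phi_image\<close>.\<close>

lemma hexagon_star: "hexagon (\<lambda>i. V (hexv i)) (star 0)"
proof -
  have c: "{(0,0), (1,0), (0,1)} \<in> cells" "{(0,0), (0,1), (-1,1)} \<in> cells"
    "{(0,0), (-1,1), (-1,0)} \<in> cells" "{(0,0), (-1,0), (0,-1)} \<in> cells"
    "{(0,0), (0,-1), (1,-1)} \<in> cells" "{(0,0), (1,-1), (1,0)} \<in> cells"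
  proof -
    have "{(0,0), (1,0), (0,1)} = up (0,0)" "{(0,0), (-1,1), (-1,0)} = up (-1,0)"
      "{(0,0), (0,-1), (1,-1)} = up (0,-1)" "{(0,0), (0,1), (-1,1)} = down (-1,0)"
      "{(0,0), (-1,0), (0,-1)} = down (-1,-1)" "{(0,0), (1,-1), (1,0)} = down (0,-1)"
      by (auto simp: up_def down_def)
    then show "{(0,0), (1,0), (0,1)} \<in> cells" "{(0,0), (0,1), (-1,1)} \<in> cells"
    "{(0,0), (-1,1), (-1,0)} \<in> cells" "{(0,0), (-1,0), (0,-1)} \<in> cells"
    "{(0,0), (0,-1), (1,-1)} \<in> cells" "{(0,0), (1,-1), (1,0)} \<in> cells"
      unfolding cells_def by auto
  qed
  define edges where "edges = {T. \<exists>S\<in>cells. T \<subseteq> S}"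
  have Int: "tri T \<inter> tri T' = tri (T \<inter> T')" if "T \<in> edges" "T' \<in> edges" for T T'
  proof -
    obtain S S' where "S \<in> cells" "T \<subseteq> S" "S' \<in> cells" "T' \<subseteq> S'" using \<open>T \<in> edges\<close> \<open>T' \<in> edges\<close> unfolding edges_def by blast
    then show ?thesis by (rule tri_Int)
  qed
  have ed: "{p, q} \<in> edges" if "S \<in> cells" "{p, q} \<subseteq> S" for p q S
    using that unfolding edges_def by blast
  have e: "{(1,0), (0,1)} \<in> edges" "{(0,1), (-1,1)} \<in> edges" "{(-1,1), (-1,0)} \<in> edges"
    "{(-1,0), (0,-1)} \<in> edges" "{(0,-1), (1,-1)} \<in> edges" "{(1,-1), (1,0)} \<in> edges"
    by (rule ed[OF c(1)] ed[OF c(2)] ed[OF c(3)] ed[OF c(4)] ed[OF c(5)] ed[OF c(6)]; simp)+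
  have img: "tri {p, q} = Phi ` closed_segment (lat p) (lat q)" if "S \<in> cells" "{p, q} \<subseteq> S" for p q S
    using Phi_rtri[OF that] by (simp add: rtri_def segment_convex_hull)
  have tri0: "tri {} = {}" "tri {p} = {V p}" for p by (simp_all add: tri_def)
  have sp: "simple_path (hexagon_boundary (\<lambda>i. V (hexv i)))"
    unfolding hexagon_boundary_def hexv_simps
    by (rule simple_path_closed_hexagon; simp add: inj_eq[OF inj_V] segment_eq_tri Int e tri0)
  have pi: "path_image (hexagon_boundary (\<lambda>i. V (hexv i))) = Phi ` {z. hexnorm z = 1}"
    unfolding hexagon_boundary_def hexv_simps hexnorm_eq_1_segments image_Un
    by (simp add: path_image_join segment_eq_tri img[OF c(1)] img[OF c(2)] img[OF c(3)]
        img[OF c(4)] img[OF c(5)] img[OF c(6)] Un_assoc)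
  have "{z. hexnorm z = 1} \<union> {z. hexnorm z < 1} = {z. hexnorm z \<le> 1}" by auto
  then show ?thesis
    unfolding hexagon_def pi inside_Phi_image inside_hexnorm_eq_1 using sp
    by (simp add: star_eq flip: image_Un)
qed

end

section \<open>Angles\<close>

text \<open>The law of cosines; with angles expressed through distances, their invariance under
  isometries is immediate.\<close>

lemma angle_dist:
  "angle a v b = arccos (((dist a v)\<^sup>2 + (dist b v)\<^sup>2 - (dist a b)\<^sup>2) / 2 / (dist a v * dist b v))"
proof -
  have "(dist a b)\<^sup>2 = (norm ((a - v) - (b - v)))\<^sup>2" by (simp add: dist_norm)
  also have "\<dots> = (dist a v)\<^sup>2 + (dist b v)\<^sup>2 - 2 * ((a - v) \<bullet> (b - v))"
    unfolding dist_norm power2_norm_eq_inner inner_diff_left[of "a - v" "b - v"] inner_diff_right[of _ "a - v" "b - v"]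
    by (simp add: inner_commute)
  finally have *: "(a - v) \<bullet> (b - v) = ((dist a v)\<^sup>2 + (dist b v)\<^sup>2 - (dist a b)\<^sup>2) / 2" by simp
  show ?thesis unfolding angle_def * dist_norm ..
qed

lemma angle_commute: "angle a v b = angle b v a"
  by (simp add: angle_def inner_commute mult.commute)

lemma angle_isometry: "isometry f \<Longrightarrow> angle (f a) (f v) (f b) = angle a v b"
  by (simp add: angle_dist isometry_def)

lemma angle_equilateral:
  assumes "dist a v = d" "dist b v = d" "dist a b = d" "d \<noteq> 0"
  shows "angle a v b = 2 * pi / 6"
proof -
  have "(d\<^sup>2 + d\<^sup>2 - d\<^sup>2) / 2 / (d * d) = cos (pi / 3)"
    using assms(4) by (simp add: power2_eq_square cos_60)
  then have "angle a v b = arccos (cos (pi / 3))" unfolding angle_dist assms(1-3) by simp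
  also have "\<dots> = pi / 3" by (rule arccos_cos) auto
  finally show ?thesis by simp
qed

text \<open>Extreme points recover the vertices of a nondegenerate triangle, and
  \<open>angle\<close> is symmetric in its two outer points, so the definite description is
  unambiguous.\<close>

lemma interior_angle_convex_hull:
  assumes "\<not> collinear {v, a, b}"
  shows "interior_angle (convex hull {v, a, b}) v = angle a v b"
  unfolding interior_angle_def
proof (rule the_equality)
  show "\<exists>a' b'. \<not> collinear {v, a', b'} \<and> convex hull {v, a, b} = convex hull {v, a', b'} \<and>
      angle a v b = angle a' v b'" using assms by blast
  fix \<theta>
  assume "\<exists>a' b'. \<not> collinear {v, a', b'} \<and> convex hull {v, a, b} = convex hull {v, a', b'} \<and> \<theta> = angle a' v b'"
  then obtain a' b' where n: "\<not> collinear {v, a', b'}"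
    and h: "convex hull {v, a, b} = convex hull {v, a', b'}" and t: "\<theta> = angle a' v b'" by blast
  have "x \<in> {v, a, b} \<longleftrightarrow> x \<in> {v, a', b'}" for x
    using extreme_point_of_convex_hull_affine_independent[of "{v, a, b}" x]
      extreme_point_of_convex_hull_affine_independent[of "{v, a', b'}" x] assms n h
    by (simp add: collinear_3_eq_affine_dependent)
  then have "{v, a, b} = {v, a', b'}" by blast
  moreover have "a \<noteq> v" "b \<noteq> v" "a' \<noteq> v" "b' \<noteq> v"
    using assms n by (auto simp: collinear_3_eq_affine_dependent)
  ultimately have "{a, b} = {a', b'}" by blast
  then show "\<theta> = angle a v b" using t angle_commute by (auto simp: doubleton_eq_iff)
qed

lemma Im_cnj_mult_eq_0_if_collinear:
  assumes "collinear {a, b, c}"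
  shows "Im (cnj (a - b) * (c - b)) = 0"
proof -
  have "collinear {0, a - b, c - b}" using assms collinear_3[of a b c] by simp
  then consider "a - b = 0" | "c - b = 0" | k where "c - b = k *\<^sub>R (a - b)"
    unfolding collinear_lemma by blast
  then show ?thesis
  proof cases
    case 3
    show ?thesis unfolding 3 by (simp add: algebra_simps)
  qed auto
qed

lemma collinear_if_Im_cnj_mult_eq_0:
  assumes "Im (cnj u * w) = 0"
  shows "collinear {0, u, w}"
proof (cases "u = 0")
  case False
  define n where "n = (Re u)\<^sup>2 + (Im u)\<^sup>2"
  have n: "n \<noteq> 0" using False by (simp add: n_def complex_eq_iff sum_power2_eq_zero_iff)
  have h: "Re u * Im w = Im u * Re w" using assms by simp
  define k where "k = (Re u * Re w + Im u * Im w) / n"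
  have "n * Re w = (Re u * Re w + Im u * Im w) * Re u" "n * Im w = (Re u * Re w + Im u * Im w) * Im u"
    unfolding n_def using h by algebra+
  then have "w = k *\<^sub>R u" using n by (simp add: complex_eq_iff k_def field_simps)
  then show ?thesis unfolding collinear_lemma by blast
qed simp

text \<open>The argument of \<open>cnj x * y\<close> lies strictly between 0 and pi, and adding pi /
  3 makes it a multiple of pi; only 2 pi / 3 qualifies.\<close>

lemma angle_eq_2pi_3:
  assumes "Im (cnj x * y) > 0" "Im (cnj x * (om * y)) = 0"
  shows "angle (v + x) v (v + y) = 2 * pi / 3"
proof -
  define P where "P = cnj x * y"
  define p q where "p = Re P" "q = Im P"
  have q: "q > 0" using assms(1) by (simp add: p_q_def P_def)
  have "cnj x * (om * y) = om * P" by (simp add: mult_ac P_def)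
  then have "Im (om * P) = 0" using assms(2) by (simp only:)
  then have "p * (sqrt 3 / 2) + q / 2 = 0" by (simp add: p_q_def mult_ac add_ac)
  then have qp: "q = - sqrt 3 * p" by (simp add: field_simps)
  then have p: "p < 0" using q by (simp add: mult_less_0_iff zero_less_mult_iff)
  have "(norm P)\<^sup>2 = p\<^sup>2 + q\<^sup>2" by (simp add: cmod_power2 p_q_def)
  also have "\<dots> = (- 2 * p)\<^sup>2" by (simp add: qp power2_eq_square)
  finally have "norm P = - 2 * p" by (rule power2_eq_imp_eq) (use p in auto)
  then have n: "norm x * norm y = - 2 * p" by (simp add: P_def norm_mult)
  have "x \<bullet> y = p" by (simp add: inner_complex_def p_q_def P_def)
  then have "angle (v + x) v (v + y) = arccos (p / (- 2 * p))"
    unfolding angle_def by (simp add: n)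
  also have "p / (- 2 * p) = - cos (pi / 3)" using p by (simp add: cos_60)
  also have "\<dots> = cos (pi - pi / 3)" by (simp only: cos_pi_minus)
  also have "arccos \<dots> = pi - pi / 3" by (rule arccos_cos) auto
  finally show ?thesis by simp
qed

section \<open>Isometries of the plane\<close>

lemma isometry_image_convex_hull:
  fixes f :: "complex \<Rightarrow> complex"
  assumes "isometry f"
  shows "f ` (convex hull X) = convex hull (f ` X)"
proof -
  define g where "g z = f z - f 0" for z
  have "orthogonal_transformation g"
    using assms by (simp add: orthogonal_transformation_isometry g_def isometry_def dist_norm)
  then have "g ` (convex hull X) = convex hull (g ` X)"
    by (intro convex_hull_linear_image) (rule orthogonal_transformation_linear)
  then have "(+) (f 0) ` g ` (convex hull X) = convex hull ((+) (f 0) ` g ` X)"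
    by (simp add: convex_hull_translation)
  then show ?thesis by (simp add: image_image g_def)
qed

text \<open>Excluding \<open>x = y\<close> keeps 0 out, so for the vertices of a triangle this is
  its set of side lengths, a singleton exactly in the equilateral case.\<close>

definition dists :: "complex set \<Rightarrow> real set" where
  "dists X = {dist x y | x y. x \<in> X \<and> y \<in> X \<and> x \<noteq> y}"

lemma dists_isometry:
  assumes "isometry f"
  shows "dists (f ` X) = dists X"
proof -
  have d: "dist (f x) (f y) = dist x y" for x y using assms by (simp add: isometry_def)
  then have i: "f x = f y \<longleftrightarrow> x = y" for x y by (metis dist_eq_0_iff)
  show ?thesis
  proof
    show "dists (f ` X) \<subseteq> dists X"
    proof
      fix t assume "t \<in> dists (f ` X)"
      then obtain x y where "t = dist x y" "x \<in> X" "y \<in> X" "x \<noteq> y"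
        by (auto simp: dists_def d i)
      then show "t \<in> dists X" unfolding dists_def by blast
    qed
    show "dists X \<subseteq> dists (f ` X)"
    proof
      fix t assume "t \<in> dists X"
      then obtain x y where "t = dist (f x) (f y)" "x \<in> X" "y \<in> X" "f x \<noteq> f y"
        by (auto simp: dists_def d i)
      then show "t \<in> dists (f ` X)" unfolding dists_def by blast
    qed
  qed
qed

lemma dists_triple:
  assumes "a \<noteq> b" "a \<noteq> c" "b \<noteq> c"
  shows "dists {a, b, c} = {dist a b, dist a c, dist b c}"
proof
  show "dists {a, b, c} \<subseteq> {dist a b, dist a c, dist b c}"
    unfolding dists_def by (auto simp: dist_commute)
  show "{dist a b, dist a c, dist b c} \<subseteq> dists {a, b, c}"
    unfolding dists_def using assms by blast
qed

section \<open>The cells\<close>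

lemma up_eq_iff: "up v = up w \<longleftrightarrow> v = w"
proof
  assume "up v = up w"
  then have "v \<in> up w" "w \<in> up v" by (auto simp: up_def)
  then show "v = w" by (cases v; cases w) (auto simp: up_def)
qed simp

lemma down_eq_iff: "down v = down w \<longleftrightarrow> v = w"
proof
  assume "down v = down w"
  then have "v + (1,1) \<in> down w" "w + (1,1) \<in> down v" by (auto simp: down_def)
  then show "v = w" by (cases v; cases w) (auto simp: down_def)
qed simp

lemma up_ne_down: "up v \<noteq> down w"
proof
  assume "up v = down w"
  then have "v \<in> down w" "v + (1,0) \<in> down w" "v + (0,1) \<in> down w" by (auto simp: up_def)
  then show False by (cases v; cases w) (auto simp: down_def)
qed

lemma act_eq_plus:
  assumes "e3 t = 1"
  shows "act t = (+) t"
proof (rule act_cases[of t])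
  assume "e3 t = kap" then show ?thesis using assms by (simp add: kap_def complex_eq_iff)
next
  assume "e3 t = kap\<^sup>2" then show ?thesis using assms by (simp add: kap_def complex_eq_iff power2_eq_square)
qed auto

lemma chi_eq: "e3 v = kap \<Longrightarrow> chi v = 1" "e3 v = kap\<^sup>2 \<Longrightarrow> chi v = cnj om"
proof -
  show "e3 v = kap \<Longrightarrow> chi v = 1" using kap_ne_1 by (simp add: chi_def)
  have "1 - kap\<^sup>2 = cnj om * (1 - kap)" by (simp add: kap_def complex_eq_iff power2_eq_square)
  then show "e3 v = kap\<^sup>2 \<Longrightarrow> chi v = cnj om" using kap_ne_1 by (simp add: chi_def)
qed

section \<open>Side lengths and angles of the deformed tiles\<close>

context folded_tiling
begin

text \<open>Up to a motion, the given triangle has vertices \<open>0\<close>, \<open>u\<close>, \<open>w\<close>.\<close>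

definition u :: complex where "u = beta + Q"
definition w :: complex where "w = beta * om + Q * cnj om"

lemma V_values: "V 0 = 0" "V (0,0) = 0" "V (1,0) = u" "V (0,1) = w" "V (-1,1) = om * w"
  "V (-1,0) = om * (w - u)" "V (0,-1) = om * om * (w - u)" "V (1,-1) = - om * om * u"
proof -
  have e: "e3 (-1,1) = kap" "e3 (-1,0) = kap\<^sup>2" "e3 (0,-1) = kap" "e3 (1,-1) = kap\<^sup>2"
    by (simp_all add: e3_eq_mod)
  show z: "V 0 = 0" by (simp add: V_def)
  then show "V (0,0) = 0" by (simp add: zero_prod_def)
  show "V (1,0) = u" "V (0,1) = w" by (simp_all add: V_def u_def w_def)
  show "V (-1,1) = om * w" "V (-1,0) = om * (w - u)" "V (0,-1) = om * om * (w - u)"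
    "V (1,-1) = - om * om * u"
    by (simp_all add: V_def chi_eq e u_def w_def lat_def complex_eq_iff algebra_simps)
qed

definition sides :: "(int \<times> int) set \<Rightarrow> real set" where
  "sides S = dists (V ` S)"

text \<open>The side length of the downward cell at \<open>v\<close> when \<open>x = e3 v\<close>.\<close>

definition down_side :: "complex \<Rightarrow> real" where
  "down_side x = norm (beta - Q * x * cnj om)"

lemma down_side_values: "down_side 1 = norm (w - u)" "down_side kap = norm u" "down_side (kap\<^sup>2) = norm w"
proof -
  have "w - u = (om - 1) * (beta - Q * cnj om)" by (simp add: u_def w_def complex_eq_iff algebra_simps)
  then show "down_side 1 = norm (w - u)" by (simp add: down_side_def norm_mult)
  have "u = beta - Q * kap * cnj om" by (simp add: u_def kap_def complex_eq_iff algebra_simps)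
  then show "down_side kap = norm u" by (simp add: down_side_def)
  have "w = om * (beta - Q * kap\<^sup>2 * cnj om)"
    by (simp add: w_def kap_def complex_eq_iff power2_eq_square algebra_simps)
  then have "norm w = norm om * norm (beta - Q * kap\<^sup>2 * cnj om)" by (metis norm_mult)
  then show "down_side (kap\<^sup>2) = norm w" by (simp add: down_side_def)
qed

text \<open>On a downward cell the deformation is a similarity with factor
  \<open>beta - Q * e3 v * cnj om\<close>: the three differences are its multiples by complex
  numbers of norm 1.\<close>

lemma dist_down:
  "dist (V (v + (1,1))) (V (v + (0,1))) = down_side (e3 v)"
  "dist (V (v + (1,1))) (V (v + (1,0))) = down_side (e3 v)"
  "dist (V (v + (1,0))) (V (v + (0,1))) = down_side (e3 v)"
proof -
  let ?m = "beta - Q * e3 v * cnj om"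
  have "V (v + (1,1)) - V (v + (0,1)) = ?m"
    by (simp add: V_def lat_add chi_add algebra_simps)
  moreover have "V (v + (1,1)) - V (v + (1,0)) = om * ?m"
    by (simp add: V_def lat_add chi_add complex_eq_iff algebra_simps)
  moreover have "V (v + (1,0)) - V (v + (0,1)) = (1 - om) * ?m"
    by (simp add: V_def lat_add chi_add complex_eq_iff algebra_simps)
  ultimately show "dist (V (v + (1,1))) (V (v + (0,1))) = down_side (e3 v)"
    "dist (V (v + (1,1))) (V (v + (1,0))) = down_side (e3 v)"
    "dist (V (v + (1,0))) (V (v + (0,1))) = down_side (e3 v)"
    by (simp_all add: dist_norm norm_mult down_side_def)
qed

lemma down_side_pos: "down_side (e3 v) > 0"
proof -
  have "V (v + (1,1)) \<noteq> V (v + (0,1))" by (simp add: inj_eq[OF inj_V])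
  then show ?thesis using dist_down(1)[of v] zero_less_dist_iff by metis
qed

lemma equilateral_down: "equilateral_triangle (down_side (e3 v)) (tri (down v))"
  unfolding equilateral_triangle_def
proof (intro conjI exI)
  show "tri (down v) = convex hull {V (v + (1,0)), V (v + (0,1)), V (v + (1,1))}"
    by (simp add: tri_def down_def)
qed (simp_all add: down_side_pos dist_down dist_commute)

lemma sides_down: "sides (down v) = {down_side (e3 v)}"
proof -
  have "V ` down v = {V (v + (1,1)), V (v + (1,0)), V (v + (0,1))}" by (auto simp: down_def)
  then show ?thesis
    unfolding sides_def by (simp add: dists_triple inj_eq[OF inj_V] dist_down)
qed

lemma sides_act: "sides (act s ` S) = sides S"
proof -
  have "V ` act s ` S = motion s ` V ` S" by (simp add: image_image motion_V)
  then show ?thesis unfolding sides_def using dists_isometry[OF isometry_motion] by metis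
qed

lemma sides_up: "sides (up v) = {norm u, norm w, norm (w - u)}"
proof -
  obtain s where "act s ` up 0 = up v" using up_eq_act by blast
  then have "sides (up v) = sides (up 0)" using sides_act by metis
  also have "V ` up 0 = {V (0,0), V (1,0), V (0,1)}" by (simp add: up_def zero_prod_def)
  then have "sides (up 0) = {dist (V (0,0)) (V (1,0)), dist (V (0,0)) (V (0,1)), dist (V (1,0)) (V (0,1))}"
    unfolding sides_def by (simp add: dists_triple inj_eq[OF inj_V])
  also have "\<dots> = {norm u, norm w, norm (w - u)}"
    by (simp add: V_values dist_norm norm_minus_commute)
  finally show ?thesis .
qed

lemma interior_angle_tri:
  assumes "{p, q, r} \<in> cells"
  shows "interior_angle (tri {p, q, r}) (V p) = angle (V q) (V p) (V r)"
proof -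
  have c: "card {p, q, r} = 3" using assms by (rule card_cell)
  have "p \<noteq> q" "p \<noteq> r" "q \<noteq> r" using c by (auto simp: card_insert_if split: if_splits)
  then have "\<not> collinear {V p, V q, V r}" by (rule not_collinear_V[OF affine_independent_V[OF assms]])
  from interior_angle_convex_hull[OF this] show ?thesis by (simp add: tri_def)
qed

lemma interior_angle_act:
  assumes "S \<in> cells" "p \<in> S"
  shows "interior_angle (tri (act s ` S)) (V (act s p)) = interior_angle (tri S) (V p)"
proof -
  have "card S = 3" using assms card_cell by blast
  then have "card (S - {p}) = 2" using assms by simp
  then obtain q r where "S - {p} = {q, r}" by (auto simp: card_2_iff)
  then have S: "S = {p, q, r}" using assms by blast
  have "act s ` S = {act s p, act s q, act s r}" by (simp add: S)
  then have "interior_angle (tri (act s ` S)) (V (act s p)) = angle (V (act s q)) (V (act s p)) (V (act s r))"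
    using interior_angle_tri act_cells[OF assms(1), of s] by simp
  also have "\<dots> = angle (V q) (V p) (V r)"
    unfolding motion_V[symmetric] by (rule angle_isometry[OF isometry_motion])
  also have "\<dots> = interior_angle (tri S) (V p)" using interior_angle_tri assms(1) S by simp
  finally show ?thesis .
qed

definition star_cells :: "(int \<times> int) set set" where
  "star_cells = {up (0,0), up (-1,0), up (0,-1), down (-1,0), down (0,-1), down (-1,-1)}"

lemma star_cells_eq: "{S \<in> cells. 0 \<in> S} = star_cells"
  by (simp add: cells_containing star_cells_def zero_prod_def)

lemma star_cells_cells: "star_cells \<subseteq> cells"
  by (auto simp: star_cells_def cells_def)

lemma star_0: "star 0 = tri (up (0,0)) \<union> tri (up (0,-1)) \<union> tri (up (-1,0)) \<union>
    tri (down (-1,-1)) \<union> tri (down (-1,0)) \<union> tri (down (0,-1))"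
  unfolding star_def star_cells_eq star_cells_def by auto

text \<open>The three upward tiles at 0 are rotated copies of one triangle, each with a different
  corner at 0. Which corner it is shows in the side lengths, via the law of cosines.\<close>

lemma angles_at_0:
  "image_mset (\<lambda>S. interior_angle (tri S) 0) (mset_set star_cells) =
    {#angle u 0 w, angle w u 0, angle 0 w u, 2 * pi / 6, 2 * pi / 6, 2 * pi / 6#}"
proof -
  have c: "up v \<in> cells" "down v \<in> cells" for v by (auto simp: cells_def)
  have ia: "interior_angle (tri S) 0 = angle (V q) 0 (V r)" if "S \<in> cells" "S = {(0,0), q, r}" for S q r
    using interior_angle_tri[of "(0,0)" q r] that by (simp add: V_values)
  have d: "om * w - om * (w - u) = om * u" "om * om * (w - u) - - om * om * u = om * om * w"
    "om * w - w = om * om * w" "- om * om * u - u = - om * u"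
    "om * om * (w - u) - om * (w - u) = - (w - u)"
    by (simp_all add: complex_eq_iff algebra_simps)
  have dd: "dist (om * w) 0 = norm w" "dist (om * (w - u)) 0 = norm (w - u)" "dist w 0 = norm w" "dist u 0 = norm u"
    "dist (om * om * (w - u)) 0 = norm (w - u)" "dist (- om * om * u) 0 = norm u"
    "dist (om * w) (om * (w - u)) = norm u" "dist (om * om * (w - u)) (- om * om * u) = norm w"
    "dist (om * w) w = norm w" "dist (- om * om * u) u = norm u"
    "dist (om * om * (w - u)) (om * (w - u)) = norm (w - u)"
    unfolding dist_norm d by (simp_all add: norm_mult norm_minus_commute[of u w])
  have "e3 (0,-1) = kap" "e3 (-1,0) = kap\<^sup>2" by (simp_all add: e3_eq_mod)
  then have nz: "norm u \<noteq> 0" "norm w \<noteq> 0" "norm (w - u) \<noteq> 0"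
    using down_side_pos[of "(0,-1)"] down_side_pos[of "(-1,0)"] down_side_pos[of 0]
    by (simp_all add: down_side_values)
  have sets: "up (0,0) = {(0,0), (1,0), (0,1)}" "up (-1,0) = {(0,0), (-1,1), (-1,0)}"
    "up (0,-1) = {(0,0), (0,-1), (1,-1)}" "down (-1,0) = {(0,0), (-1,1), (0,1)}"
    "down (0,-1) = {(0,0), (1,-1), (1,0)}" "down (-1,-1) = {(0,0), (0,-1), (-1,0)}"
    by (auto simp: up_def down_def)
  note ias = ia[OF c(1) sets(1)] ia[OF c(1) sets(2)] ia[OF c(1) sets(3)]
    ia[OF c(2) sets(4)] ia[OF c(2) sets(5)] ia[OF c(2) sets(6)]
  have 1: "interior_angle (tri (up (0,0))) 0 = angle u 0 w"
    unfolding ias(1) V_values ..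
  have 2: "interior_angle (tri (up (-1,0))) 0 = angle 0 w u"
    unfolding ias(2) V_values angle_dist dd by (simp add: dist_norm norm_minus_commute)
  have 3: "interior_angle (tri (up (0,-1))) 0 = angle w u 0"
    unfolding ias(3) V_values angle_dist dd by (simp add: dist_norm)
  have 4: "interior_angle (tri (down (-1,0))) 0 = 2 * pi / 6"
    unfolding ias(4) V_values by (rule angle_equilateral[OF dd(1,3,9) nz(2)])
  have 5: "interior_angle (tri (down (0,-1))) 0 = 2 * pi / 6"
    unfolding ias(5) V_values by (rule angle_equilateral[OF dd(6,4,10) nz(1)])
  have 6: "interior_angle (tri (down (-1,-1))) 0 = 2 * pi / 6"
    unfolding ias(6) V_values by (rule angle_equilateral[OF dd(5,2,11) nz(3)])
  show ?thesis
    unfolding star_cells_def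
    by (simp add: up_eq_iff down_eq_iff up_ne_down up_ne_down[symmetric] 1 2 3 4 5 6)
qed

lemma angles_at_vertex:
  "image_mset (\<lambda>K. interior_angle K (V v)) (mset_set {K \<in> tri ` cells. V v extreme_point_of K}) =
    {#angle u 0 w, angle w u 0, angle 0 w u, 2 * pi / 6, 2 * pi / 6, 2 * pi / 6#}"
proof -
  have "{K \<in> tri ` cells. V v extreme_point_of K} = tri ` {S \<in> cells. v \<in> S}"
  proof -
    have "V v extreme_point_of tri S \<longleftrightarrow> v \<in> S" if "S \<in> cells" for S
      using extreme_point_of_tri[OF that] by (simp add: inj_image_mem_iff[OF inj_V])
    then show ?thesis by blast
  qed
  also have "{S \<in> cells. v \<in> S} = (`) (act v) ` star_cells"
    using act_cells_containing[of v 0] by (simp add: star_cells_eq)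
  finally have *: "{K \<in> tri ` cells. V v extreme_point_of K} = (\<lambda>S. tri (act v ` S)) ` star_cells"
    by (simp add: image_image)
  have "inj (act v)"
    by (rule injI) (metis act_act act_inverse act_0(1))
  then have "inj_on (\<lambda>S. tri (act v ` S)) star_cells"
  proof (intro inj_onI)
    fix S S' assume S: "S \<in> star_cells" "S' \<in> star_cells" "tri (act v ` S) = tri (act v ` S')"
    then have "act v ` S \<in> cells" "act v ` S' \<in> cells" using star_cells_cells act_cells by blast+
    then have "act v ` S = act v ` S'" using S(3) by (simp only: tri_eq_iff)
    then show "S = S'" using \<open>inj (act v)\<close> by (simp only: inj_image_eq_iff)
  qed
  then have "image_mset (\<lambda>K. interior_angle K (V v)) (mset_set ((\<lambda>S. tri (act v ` S)) ` star_cells)) =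
    image_mset (\<lambda>S. interior_angle (tri (act v ` S)) (V v)) (mset_set star_cells)"
    by (simp add: image_mset_mset_set[symmetric] multiset.map_comp comp_def)
  also have "\<dots> = image_mset (\<lambda>S. interior_angle (tri S) 0) (mset_set star_cells)"
  proof (rule image_mset_cong)
    fix S assume "S \<in># mset_set star_cells"
    then have "S \<in> cells" "0 \<in> S" using star_cells_eq by (auto simp: star_cells_def)
    from interior_angle_act[OF this, of v] show "interior_angle (tri (act v ` S)) (V v) = interior_angle (tri S) 0"
      by (simp add: V_values)
  qed
  finally show ?thesis unfolding * angles_at_0 .
qed

text \<open>The base points of the three upward cells at 0 have three different colours, and a
  translation of colour 1 reaches any upward cell from the one with the same colour.\<close>

lemma T_tiles_translates:
  "{f ` K | f K. f \<in> {motion t | t. e3 t = 1} \<and> K \<in> {tri (up (0,0)), tri (up (0,-1)), tri (up (-1,0))}} = T_tiles"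
  (is "?L = _")
proof
  show "?L \<subseteq> T_tiles"
  proof clarify
    fix t K assume "K \<in> {tri (up (0,0)), tri (up (0,-1)), tri (up (-1,0))}"
    then have "K \<in> T_tiles" by (auto simp: T_tiles_def)
    then show "motion t ` K \<in> T_tiles" using motion_T_tiles[of t] by blast
  qed
  show "T_tiles \<subseteq> ?L"
  proof
    fix K assume "K \<in> T_tiles"
    then obtain v where K: "K = tri (up v)" by (auto simp: T_tiles_def)
    have *: "K = motion (v - a) ` tri (up a)" if "e3 (v - a) = 1" for a
      by (simp add: K motion_tri act_eq_plus[OF that] plus_up)
    consider "e3 v = 1" | "e3 v = kap" | "e3 v = kap\<^sup>2" using e3_cases by blast
    then show "K \<in> ?L"
    proof cases
      case 1
      have "v - (0,0) = v" by (simp add: prod_eq_iff)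
      then have "K = motion v ` tri (up (0,0))" using *[of "(0,0)"] 1 by simp
      then show ?thesis using 1 by blast
    next
      case 2
      have eq: "v - (0,-1) = v + (0,1)" by (simp add: prod_eq_iff)
      have "e3 (v - (0,-1)) = e3 v * kap\<^sup>2" unfolding eq by (rule e3_step)
      then have "e3 (v - (0,-1)) = 1" using 2 by simp
      then show ?thesis using *[of "(0,-1)"] by blast
    next
      case 3
      have eq: "v - (-1,0) = v + (1,0)" by (simp add: prod_eq_iff)
      have "e3 (v - (-1,0)) = e3 v * kap" unfolding eq by (rule e3_step)
      then have "e3 (v - (-1,0)) = 1" using 3 by simp
      then show ?thesis using *[of "(-1,0)"] by blast
    qed
  qed
qed

lemma E_tiles_translates: "{f ` tri (down a) | f. f \<in> {motion t | t. e3 t = 1}} = E_tiles (e3 a)"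
proof
  have "tri (down a) \<in> E_tiles (e3 a)" by (auto simp: E_tiles_def)
  then show "{f ` tri (down a) | f. f \<in> {motion t | t. e3 t = 1}} \<subseteq> E_tiles (e3 a)" using motion_E_tiles by blast
  show "E_tiles (e3 a) \<subseteq> {f ` tri (down a) | f. f \<in> {motion t | t. e3 t = 1}}"
  proof
    fix K assume "K \<in> E_tiles (e3 a)"
    then obtain v where v: "K = tri (down v)" "e3 v = e3 a" by (auto simp: E_tiles_def)
    have "e3 (v - a) * e3 a = e3 v" by (simp flip: e3_add)
    then have t: "e3 (v - a) = 1" using v by simp
    then have "K = motion (v - a) ` tri (down a)" by (simp add: v motion_tri act_eq_plus plus_down)
    then show "K \<in> {f ` tri (down a) | f. f \<in> {motion t | t. e3 t = 1}}" using t by blast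
  qed
qed

lemma isometry_vertices:
  assumes "isometry f" "S \<in> cells" "S' \<in> cells" "f ` tri S = tri S'"
  shows "f ` V ` S = V ` S'" and "sides S = sides S'"
proof -
  have inj: "inj f" using assms(1) unfolding isometry_def by (metis dist_eq_0_iff injI)
  have "convex hull (f ` V ` S) = tri S'"
    using assms by (simp add: tri_def isometry_image_convex_hull)
  then have "V ` S' \<subseteq> f ` V ` S"
    using extreme_point_of_tri[OF assms(3)] extreme_point_of_convex_hull by (metis subsetI)
  moreover have "card (f ` V ` S) = card (V ` S')"
    using inj inj_V by (simp add: card_image inj_on_subset card_cell assms)
  moreover have "finite (f ` V ` S)" using finite_cell assms by blast
  ultimately show eq: "f ` V ` S = V ` S'" by (metis card_subset_eq)
  show "sides S = sides S'"
    using dists_isometry[OF assms(1), of "V ` S"] by (simp add: sides_def eq)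
qed

text \<open>An upward tile now has three side lengths, a downward tile just one, which reveals its
  colour. Side lengths thus characterise each family, and an isometry preserving the tiling
  preserves the families.\<close>

lemma symmetries_scalene:
  assumes "norm u \<noteq> norm w" "norm u \<noteq> norm (w - u)" "norm w \<noteq> norm (w - u)"
  shows "symmetries {tri ` cells} = range motion"
proof
  show "range motion \<subseteq> symmetries {tri ` cells}"
  proof clarify
    fix s
    have "(`) (motion s) ` tri ` cells = tri ` cells"
      unfolding tri_cells_eq image_Un motion_T_tiles motion_E_tiles ..
    then show "motion s \<in> symmetries {tri ` cells}" by (simp add: symmetries_def isometry_motion)
  qed
  define fam where "fam X = {tri S | S. S \<in> cells \<and> sides S = X}" for X
  have ds: "down_side x = down_side y \<longleftrightarrow> x = y" if "x \<in> {1, kap, kap\<^sup>2}" "y \<in> {1, kap, kap\<^sup>2}" for x y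
    using that assms by (auto simp: down_side_values)
  have e3_mem: "e3 v \<in> {1, kap, kap\<^sup>2}" for v using e3_cases by blast
  have ne: "sides (up v) \<noteq> {x}" for v x using assms by (auto simp: sides_up)
  have T_tiles: "T_tiles = fam {norm u, norm w, norm (w - u)}"
    unfolding T_tiles_def fam_def cells_def using ne sides_up sides_down by (auto; metis)
  have E_tiles: "E_tiles x = fam {down_side x}" if "x \<in> {1, kap, kap\<^sup>2}" for x
  proof -
    have "sides (down v) = {down_side x} \<longleftrightarrow> e3 v = x" for v
      using ds[OF e3_mem that] by (simp add: sides_down)
    then show ?thesis unfolding E_tiles_def fam_def cells_def using ne by auto
  qed
  show "symmetries {tri ` cells} \<subseteq> range motion"
  proof
    fix f assume "f \<in> symmetries {tri ` cells}"
    then have f: "isometry f" "(`) f ` tri ` cells = tri ` cells" by (auto simp: symmetries_def)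
    have fam: "(`) f ` fam X = fam X" for X
    proof
      show "(`) f ` fam X \<subseteq> fam X"
      proof clarify
        fix K assume "K \<in> fam X"
        then obtain S where S: "K = tri S" "S \<in> cells" "sides S = X" by (auto simp: fam_def)
        then have "f ` K \<in> tri ` cells" using f(2) by blast
        then obtain S' where S': "f ` K = tri S'" "S' \<in> cells" by blast
        have "sides S = sides S'" using isometry_vertices(2)[OF f(1) S(2) S'(2)] S S' by simp
        then show "f ` K \<in> fam X" unfolding fam_def using S S' by blast
      qed
      show "fam X \<subseteq> (`) f ` fam X"
      proof
        fix L assume "L \<in> fam X"
        then obtain S' where S': "L = tri S'" "S' \<in> cells" "sides S' = X" by (auto simp: fam_def)
        then have "L \<in> (`) f ` tri ` cells" using f(2) by blast
        then obtain S where S: "L = f ` tri S" "S \<in> cells" by blast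
        have "sides S = sides S'" using isometry_vertices(2)[OF f(1) S(2) S'(2)] S S' by simp
        then show "L \<in> (`) f ` fam X" unfolding fam_def using S S' by blast
      qed
    qed
    have "f \<in> symmetries {T_tiles, E_tiles 1, E_tiles (kap\<^sup>2), E_tiles kap}"
      using f(1) fam by (simp add: symmetries_def T_tiles E_tiles)
    then show "f \<in> range motion" by (simp add: symmetries_eq)
  qed
qed

lemma Im_cnj_u_w: "Im (cnj u * w) > 0"
proof -
  have *: "Im (cnj u * w) = sqrt 3 / 2 * ((norm beta)\<^sup>2 - (norm Q)\<^sup>2)"
    unfolding cmod_power2 by (simp add: u_def w_def power2_eq_square algebra_simps)
  have "(norm Q)\<^sup>2 < (norm beta)\<^sup>2" using norm_less by (intro power_strict_mono) auto
  then show ?thesis unfolding * by simp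
qed

text \<open>At each corner of the hexagon one copy of the triangle meets one equilateral tile, so a
  straight corner needs an angle 2 pi / 3 in the copy. Each of the three angles occurs at two
  corners, which leaves three conditions.\<close>

lemma no_straight_vertex_hexagon:
  assumes "2 * pi / 3 \<notin> {angle u 0 w, angle w u 0, angle 0 w u}"
  shows "no_straight_vertex (\<lambda>i. V (hexv i))"
proof -
  have pos: "Im (cnj u * w) > 0" "Im (cnj (w - u) * (- u)) > 0" "Im (cnj (- w) * (u - w)) > 0"
    using Im_cnj_u_w by (simp_all add: algebra_simps)
  have 1: "Im (cnj u * (om * w)) \<noteq> 0"
    using angle_eq_2pi_3[OF pos(1), of 0] assms by auto
  have 2: "Im (cnj (w - u) * (om * (- u))) \<noteq> 0"
    using angle_eq_2pi_3[OF pos(2), of u] assms by auto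
  have 3: "Im (cnj (- w) * (om * (u - w))) \<noteq> 0"
    using angle_eq_2pi_3[OF pos(3), of w] assms by auto
  have *: "\<not> collinear {a, b, c}" if "Im (cnj (a - b) * (c - b)) \<noteq> 0" for a b c
    using that Im_cnj_mult_eq_0_if_collinear by blast
  have c: "\<not> collinear {u, w, om * w}" "\<not> collinear {w, om * w, om * (w - u)}"
    "\<not> collinear {om * w, om * (w - u), om * om * (w - u)}"
    "\<not> collinear {om * (w - u), om * om * (w - u), - om * om * u}"
    "\<not> collinear {om * om * (w - u), - om * om * u, u}"
    "\<not> collinear {- om * om * u, u, w}"
    by (rule *, use 1 2 3 in \<open>simp add: algebra_simps\<close>)+
  have hexv2: "hexv (Suc (Suc 0)) = (-1,1)" by (simp add: hexv_def)
  show ?thesis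
    unfolding no_straight_vertex_def
  proof (intro allI impI)
    fix i :: nat assume "i < 6"
    then have "i \<in> {0, 1, 2, 3, 4, 5}" by auto
    then show "\<not> collinear {V (hexv i), V (hexv ((i + 1) mod 6)), V (hexv ((i + 2) mod 6))}"
      by (elim insertE emptyE; simp only:; simp add: hexv2 V_values c[simplified])
  qed
qed

end

section \<open>Fitting the deformed tiling to the given triangle\<close>

theorem mainTheorem1:
  fixes A B C :: complex
  assumes "\<not> collinear {A, B, C}"
  shows "\<exists>T1 T2 T3 E1 E2 E3 H h P \<T> \<E>1 \<E>2 \<E>3 \<K> p q r.
    (\<forall>K\<in>{T1, T2, T3}. isometric (convex hull {A, B, C}) K) \<and>
    equilateral_triangle (dist B C) E1 \<and>
    equilateral_triangle (dist C A) E2 \<and>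
    equilateral_triangle (dist A B) E3 \<and>
    distinct [T1, T2, T3, E1, E2, E3] \<and>
    triangulation {T1, T2, T3, E1, E2, E3} \<and>
    H = T1 \<union> T2 \<union> T3 \<union> E1 \<union> E2 \<union> E3 \<and>
    hexagon h H \<and>
    (2 * pi / 3 \<notin> {angle B A C, angle C B A, angle A C B} \<longrightarrow> no_straight_vertex h) \<and>
    tiles_plane H P \<and>
    \<T> = {f ` K | f K. f \<in> P \<and> K \<in> {T1, T2, T3}} \<and>
    \<E>1 = {f ` E1 | f. f \<in> P} \<and>
    \<E>2 = {f ` E2 | f. f \<in> P} \<and>
    \<E>3 = {f ` E3 | f. f \<in> P} \<and>
    \<K> = \<T> \<union> \<E>1 \<union> \<E>2 \<union> \<E>3 \<and>
    plane_triangulation \<K> \<and>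
    p \<noteq> q \<and> dist p q = dist q r \<and> dist q r = dist r p \<and>
    symmetries {\<T>, \<E>1, \<E>2, \<E>3} = S333 p q r \<and>
    (dist B C \<noteq> dist C A \<and> dist C A \<noteq> dist A B \<and> dist A B \<noteq> dist B C \<longrightarrow>
       symmetries {\<K>} = S333 p q r) \<and>
    (\<forall>v. (\<exists>K\<in>\<K>. v extreme_point_of K) \<longrightarrow>
       image_mset (\<lambda>K. interior_angle K v) (mset_set {K \<in> \<K>. v extreme_point_of K}) =
       {#angle B A C, angle C B A, angle A C B, 2 * pi / 6, 2 * pi / 6, 2 * pi / 6#})"
proof -
  \<comment> \<open>Positive orientation is what yields \<open>norm Q < norm beta\<close>; a
    clockwise triangle is reflected by \<open>cnj\<close>.\<close>
  obtain g where g: "isometry g" "g A = 0" "Im (cnj (g B) * g C) > 0"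
  proof (cases "Im (cnj (B - A) * (C - A)) > 0")
    case True
    show ?thesis
      by (rule that[of "\<lambda>z. z - A"]) (use True in \<open>simp_all add: isometry_def dist_norm\<close>)
  next
    case False
    have "\<not> collinear {0, B - A, C - A}"
      using assms collinear_3[of B A C] by (simp add: insert_commute)
    then have "Im (cnj (B - A) * (C - A)) \<noteq> 0" using collinear_if_Im_cnj_mult_eq_0 by blast
    then have neg: "Im (cnj (B - A) * (C - A)) < 0" using False by simp
    have "dist (cnj (x - A)) (cnj (y - A)) = dist x y" for x y
      unfolding dist_norm complex_cnj_diff[symmetric] complex_mod_cnj by simp
    then show ?thesis
      by (intro that[of "\<lambda>z. cnj (z - A)"]) (use neg in \<open>simp_all add: isometry_def algebra_simps\<close>)
  qed
  define u0 w0 where "u0 = g B" "w0 = g C"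
  \<comment> \<open>Cramer's rule for \<open>beta + Q = u0\<close> and
    \<open>beta * om + Q * cnj om = w0\<close>.\<close>
  define beta where "beta = (w0 - cnj om * u0) / (om - cnj om)"
  define Q where "Q = (om * u0 - w0) / (om - cnj om)"
  have omd: "om - cnj om \<noteq> 0" by (simp add: complex_eq_iff)
  have "(norm (om * u0 - w0))\<^sup>2 < (norm (w0 - cnj om * u0))\<^sup>2"
  proof -
    have "(norm (w0 - cnj om * u0))\<^sup>2 - (norm (om * u0 - w0))\<^sup>2 = 2 * sqrt 3 * Im (cnj u0 * w0)"
      unfolding cmod_power2 by (simp add: power2_eq_square algebra_simps)
    moreover have "0 < 2 * sqrt 3 * Im (cnj u0 * w0)"
      using g(3) unfolding u0_w0_def by (intro mult_pos_pos) auto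
    ultimately show ?thesis by linarith
  qed
  then have "norm (om * u0 - w0) < norm (w0 - cnj om * u0)" by (rule power2_less_imp_less) simp
  then have "norm Q < norm beta"
    using omd by (simp add: Q_def beta_def norm_divide divide_strict_right_mono)
  then interpret folded_tiling beta Q by unfold_locales
  have u: "u = g B"
  proof -
    have "u = (om - cnj om) * u0 / (om - cnj om)"
      unfolding u_def unfolding beta_def Q_def by (simp add: algebra_simps flip: add_divide_distrib)
    then show ?thesis using omd by (simp add: u0_w0_def)
  qed
  have w: "w = g C"
  proof -
    have "w = ((w0 - cnj om * u0) * om + (om * u0 - w0) * cnj om) / (om - cnj om)"
      unfolding w_def unfolding beta_def Q_def by (simp add: add_divide_distrib)
    also have "(w0 - cnj om * u0) * om + (om * u0 - w0) * cnj om = w0 * (om - cnj om)"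
      by (simp add: algebra_simps)
    finally show ?thesis using omd by (simp add: u0_w0_def)
  qed
  have gd: "dist (g x) (g y) = dist x y" for x y using g(1) by (simp add: isometry_def)
  have dists: "dist B C = norm (w - u)" "dist C A = norm w" "dist A B = norm u"
    using gd[of B C] gd[of C A] gd[of A B] by (simp_all add: u w g(2) dist_norm norm_minus_commute)
  have angles: "angle B A C = angle u 0 w" "angle C B A = angle w u 0" "angle A C B = angle 0 w u"
    using angle_isometry[OF g(1)] by (simp_all add: u w flip: g(2))
  let ?T1 = "tri (up (0,0))" and ?T2 = "tri (up (0,-1))" and ?T3 = "tri (up (-1,0))"
  \<comment> \<open>The three downward cells at 0, ordered so that \<open>down_side_values\<close>
    gives the sides opposite \<open>A\<close>, \<open>B\<close>, \<open>C\<close>.\<close>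
  let ?E1 = "tri (down (-1,-1))" and ?E2 = "tri (down (-1,0))" and ?E3 = "tri (down (0,-1))"
  let ?P = "{motion t | t. e3 t = 1}"
  have e: "e3 (-1,-1) = 1" "e3 (-1,0) = kap\<^sup>2" "e3 (0,-1) = kap"
    "e3 (0,1) = kap\<^sup>2" "e3 (1,-1) = kap\<^sup>2" by (simp_all add: e3_eq_mod)
  have c: "up v \<in> cells" "down v \<in> cells" for v by (auto simp: cells_def)
  have isom: "isometric (convex hull {A, B, C}) (tri (up v))" for v
  proof -
    obtain s where s: "act s ` up 0 = up v" using up_eq_act by blast
    have "tri (up 0) = convex hull {0, u, w}"
      by (simp add: tri_def up_def V_values)
    then have "g ` (convex hull {A, B, C}) = tri (up 0)"
      by (simp add: isometry_image_convex_hull[OF g(1)] g(2) u w)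
    then have "(motion s \<circ> g) ` (convex hull {A, B, C}) = tri (up v)"
      unfolding image_comp[symmetric] by (simp add: motion_tri s)
    moreover have "isometry (motion s \<circ> g)" using isometry_motion[of s] g(1) by (simp add: isometry_def)
    ultimately show ?thesis unfolding isometric_def by blast
  qed
  have eq: "equilateral_triangle (dist B C) ?E1" "equilateral_triangle (dist C A) ?E2"
    "equilateral_triangle (dist A B) ?E3"
    using equilateral_down[of "(-1,-1)"] equilateral_down[of "(-1,0)"] equilateral_down[of "(0,-1)"]
    by (simp_all add: e down_side_values dists)
  have dst: "distinct [?T1, ?T2, ?T3, ?E1, ?E2, ?E3]"
    by (simp add: tri_eq_iff c up_eq_iff down_eq_iff up_ne_down)
  have tr: "triangulation {?T1, ?T2, ?T3, ?E1, ?E2, ?E3}"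
    unfolding triangulation_def
  proof (intro conjI ballI allI impI)
    have sub: "{?T1, ?T2, ?T3, ?E1, ?E2, ?E3} \<subseteq> tri ` cells" using c by simp
    show "finite {?T1, ?T2, ?T3, ?E1, ?E2, ?E3}" by simp
    show "\<exists>n. n simplex K" if "K \<in> {?T1, ?T2, ?T3, ?E1, ?E2, ?E3}" for K
    proof -
      have "K \<in> tri ` cells" using that sub by (rule rev_subsetD)
      then show ?thesis using simplex_tri by blast
    qed
    fix K L assume "K \<in> {?T1, ?T2, ?T3, ?E1, ?E2, ?E3} \<and> L \<in> {?T1, ?T2, ?T3, ?E1, ?E2, ?E3}"
    then have "K \<in> tri ` cells" "L \<in> tri ` cells" using sub by (meson subsetD)+
    then show "(K \<inter> L) face_of K" using face_tri by blast
  qed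
  have EEs: "{f ` ?E1 | f. f \<in> ?P} = E_tiles 1" "{f ` ?E2 | f. f \<in> ?P} = E_tiles (kap\<^sup>2)" "{f ` ?E3 | f. f \<in> ?P} = E_tiles kap"
    using E_tiles_translates[of "(-1,-1)"] E_tiles_translates[of "(-1,0)"] E_tiles_translates[of "(0,-1)"]
    by (simp_all add: e)
  \<comment> \<open>The centres of \<open>?E2\<close>, \<open>?E1\<close>, \<open>?E3\<close>, each
    of which is mapped to itself by the rotation about its centre.\<close>
  let ?p = "center (0,1)" and ?q = "center (-1,0)" and ?r = "center (1,-1)"
  have "(0,1) - (-1,0) = (1::int, 1::int)" "(-1,0) - (1,-1) = (-2::int, 1::int)" "(1,-1) - (0,1) = (1::int, -2::int)"
    by simp_all
  moreover have "norm (lat (1,1)) = sqrt 3" "norm (lat (-2,1)) = sqrt 3" "norm (lat (1,-2)) = sqrt 3"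
    by (simp_all add: lat_def cmod_def power2_eq_square algebra_simps)
  ultimately have n3: "norm (lat ((0,1) - (-1,0))) = sqrt 3" "norm (lat ((-1,0) - (1,-1))) = sqrt 3"
    "norm (lat ((1,-1) - (0,1))) = sqrt 3" by (simp_all only:)
  define D where "D = norm beta * sqrt 3 / norm (1 - kap\<^sup>2)"
  have D: "dist ?p ?q = D" "dist ?q ?r = D" "dist ?r ?p = D"
    unfolding D_def dist_center[OF trans[OF e(4) e(2)[symmetric]]] dist_center[OF trans[OF e(2) e(5)[symmetric]]]
      dist_center[OF trans[OF e(5) e(4)[symmetric]]] n3 by (rule refl)+
  have "beta \<noteq> 0" using \<open>norm Q < norm beta\<close> by auto
  then have "D \<noteq> 0" using kap_sq_ne_1 by (simp add: D_def)
  then have pq: "?p \<noteq> ?q" using D(1) by auto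
  have sym: "symmetries {T_tiles, E_tiles 1, E_tiles (kap\<^sup>2), E_tiles kap} = S333 ?p ?q ?r"
    by (simp add: symmetries_eq S333_eq)
  have scal: "dist B C \<noteq> dist C A \<and> dist C A \<noteq> dist A B \<and> dist A B \<noteq> dist B C \<longrightarrow>
       symmetries {tri ` cells} = S333 ?p ?q ?r"
    using symmetries_scalene unfolding S333_eq dists by metis
  have ang: "\<forall>v. (\<exists>K\<in>tri ` cells. v extreme_point_of K) \<longrightarrow>
       image_mset (\<lambda>K. interior_angle K v) (mset_set {K \<in> tri ` cells. v extreme_point_of K}) =
       {#angle B A C, angle C B A, angle A C B, 2 * pi / 6, 2 * pi / 6, 2 * pi / 6#}"
  proof (intro allI impI)
    fix v assume "\<exists>K\<in>tri ` cells. v extreme_point_of K"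
    then obtain s where v: "v = V s" using extreme_point_of_tri by blast
    show "image_mset (\<lambda>K. interior_angle K v) (mset_set {K \<in> tri ` cells. v extreme_point_of K}) =
       {#angle B A C, angle C B A, angle A C B, 2 * pi / 6, 2 * pi / 6, 2 * pi / 6#}"
      unfolding v angles by (rule angles_at_vertex)
  qed
  show ?thesis
    apply (rule exI[of _ ?T1], rule exI[of _ ?T2], rule exI[of _ ?T3],
        rule exI[of _ ?E1], rule exI[of _ ?E2], rule exI[of _ ?E3], rule exI[of _ "star 0"],
        rule exI[of _ "\<lambda>i. V (hexv i)"], rule exI[of _ ?P], rule exI[of _ T_tiles],
        rule exI[of _ "E_tiles 1"], rule exI[of _ "E_tiles (kap\<^sup>2)"], rule exI[of _ "E_tiles kap"],
        rule exI[of _ "tri ` cells"], rule exI[of _ ?p], rule exI[of _ ?q], rule exI[of _ ?r])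
    apply (intro conjI)
    subgoal using isom by blast
    subgoal by (rule eq(1))
    subgoal by (rule eq(2))
    subgoal by (rule eq(3))
    subgoal by (rule dst)
    subgoal by (rule tr)
    subgoal by (rule star_0)
    subgoal by (rule hexagon_star)
    subgoal using no_straight_vertex_hexagon unfolding angles by blast
    subgoal by (rule tiles_plane_star)
    subgoal by (rule T_tiles_translates[symmetric])
    subgoal by (rule EEs(1)[symmetric])
    subgoal by (rule EEs(2)[symmetric])
    subgoal by (rule EEs(3)[symmetric])
    subgoal by (rule tri_cells_eq)
    subgoal by (rule plane_triangulation_cells)
    subgoal by (rule pq)
    subgoal by (simp add: D)
    subgoal by (simp add: D)
    subgoal by (rule sym)
    subgoal by (rule scal)
    subgoal by (rule ang)
    done
qed

end
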